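(* Let $H$ be a real inner product space (not necessarily complete) with $\dim H\geq 3$ (possibly infinite). Let $\alpha\in\left(0,\tfrac{\pi}{2}\right)$ and let $\phi\colon P(H)\to P(H)$ be a bijective map satisfying $$\measuredangle([u],[v])=\alpha \iff \measuredangle(\phi([u]),\phi([v]))=\alpha \quad ([u],[v]\in P(H)).$$ Then $\phi$ is a Wigner symmetry, i.e. there exists a bijective linear isometry $O\colon H\to H$ such that $\phi([v])=[Ov]$ for every $[v]\in P(H)$.
   Context: $P(H)$ is the set of all one-dimensional subspaces (lines) of $H$; for $0\neq v\in H$, $[v]$ is the line generated by $v$. The angle between lines is $\measuredangle([u],[v])=\arccos\frac{|\langle u,v\rangle|}{\|u\|\,\|v\|}\in\left[0,\tfrac{\pi}{2}\right]$. *)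

theory Defs
  imports "HOL-Analysis.Analysis"
begin

definition lines :: "'a::real_inner set set" where
  "lines = {L. subspace L \<and> dim L = 1}"

definition line_of :: "'a::real_inner \<Rightarrow> 'a set" where
  "line_of v = span {v}"

text \<open>The value does not depend on the generators chosen; see \<open>line_angle_line_of\<close>.\<close>

definition line_angle :: "'a::real_inner set \<Rightarrow> 'a set \<Rightarrow> real" where
  "line_angle L M = (THE \<theta>. \<forall>u v. u \<noteq> 0 \<longrightarrow> v \<noteq> 0 \<longrightarrow> L = line_of u \<longrightarrow> M = line_of v \<longrightarrow>
     \<theta> = arccos (\<bar>u \<bullet> v\<bar> / (norm u * norm v)))"

text \<open>\<^const>\<open>dim\<close> is 0 on infinite-dimensional spaces, so a lower bound on the dimension
  is expressed by a (Hamel) basis that is infinite or has at least \<^term>\<open>n\<close> elements.\<close>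

definition dim_at_least :: "nat \<Rightarrow> 'a::real_vector itself \<Rightarrow> bool" where
  "dim_at_least n _ \<longleftrightarrow>
     (\<exists>B::'a set. independent B \<and> span B = UNIV \<and> (finite B \<longrightarrow> n \<le> card B))"

text \<open>A linear map is an isometry iff it preserves the norm.\<close>

definition wigner_symmetry :: "('a::real_inner set \<Rightarrow> 'a set) \<Rightarrow> bool" where
  "wigner_symmetry \<phi> \<longleftrightarrow>
     (\<exists>U::'a \<Rightarrow> 'a. linear U \<and> bij U \<and> (\<forall>v. norm (U v) = norm v) \<and>
        (\<forall>v. v \<noteq> 0 \<longrightarrow> \<phi> (line_of v) = line_of (U v)))"

lemma line_of_eqD:
  assumes "line_of u = line_of v" "u \<noteq> 0"
  obtains c where "c \<noteq> 0" "u = c *\<^sub>R v"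
proof -
  have "u \<in> line_of v"
    using assms(1) span_base[of u "{u}"] by (simp add: line_of_def)
  then obtain c where "u = c *\<^sub>R v"
    by (auto simp: line_of_def span_singleton)
  with assms(2) that show thesis
    by auto
qed

lemma line_angle_line_of:
  assumes "u \<noteq> 0" "v \<noteq> 0"
  shows "line_angle (line_of u) (line_of v) = arccos (\<bar>u \<bullet> v\<bar> / (norm u * norm v))"
  unfolding line_angle_def
proof (rule the_equality)
  show "\<forall>u' v'. u' \<noteq> 0 \<longrightarrow> v' \<noteq> 0 \<longrightarrow> line_of u = line_of u' \<longrightarrow> line_of v = line_of v' \<longrightarrow>
    arccos (\<bar>u \<bullet> v\<bar> / (norm u * norm v)) = arccos (\<bar>u' \<bullet> v'\<bar> / (norm u' * norm v'))"
  proof (intro allI impI)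
    fix u' v' assume nz: "u' \<noteq> 0" "v' \<noteq> 0" and eq: "line_of u = line_of u'" "line_of v = line_of v'"
    obtain c where c: "c \<noteq> 0" "u = c *\<^sub>R u'"
      using line_of_eqD[OF eq(1) assms(1)] by blast
    obtain d where d: "d \<noteq> 0" "v = d *\<^sub>R v'"
      using line_of_eqD[OF eq(2) assms(2)] by blast
    show "arccos (\<bar>u \<bullet> v\<bar> / (norm u * norm v)) = arccos (\<bar>u' \<bullet> v'\<bar> / (norm u' * norm v'))"
      using c d nz by (simp add: abs_mult)
  qed
qed (use assms in blast)

lemma line_of_in_lines: "v \<noteq> 0 \<Longrightarrow> line_of v \<in> lines"
  by (simp add: lines_def line_of_def dim_span_eq_card_independent del: dim_span)

lemma lines_eq: "lines = line_of ` (UNIV - {0})"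
proof (intro set_eqI iffI)
  fix L :: "'a set" assume "L \<in> lines"
  then have L: "subspace L" "dim L = 1"
    by (auto simp: lines_def)
  obtain B where B: "B \<subseteq> L" "independent B" "L \<subseteq> span B" "card B = dim L"
    using basis_exists by blast
  obtain v where v: "B = {v}"
    using B(4) L(2) by (metis card_1_singletonE)
  have "L = line_of v"
    using B v L(1) span_minimal[of B L] by (auto simp: line_of_def)
  moreover have "v \<noteq> 0"
    using B(2) v dependent_zero by auto
  ultimately show "L \<in> line_of ` (UNIV - {0})"
    by blast
qed (auto intro: line_of_in_lines)

end

theory Submission
  imports Defs
begin

text \<open>Call \<open>t\<close> preserved if \<open>\<bar>x \<bullet> y\<bar> = t\<close> is equivalent to \<open>\<bar>f x \<bullet> f y\<bar> = t\<close> for all unit vectors \<open>x\<close>, \<open>y\<close>,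
  where \<open>f\<close> picks unit vectors on the image lines. Any relation definable from a preserved one is
  preserved, and this produces new preserved values from a preserved \<open>c\<close>:
  \<^item> \<open>2 * c^2 - 1\<close> if \<open>2 * c^2 > 1\<close>: there is exactly one common neighbour;
  \<^item> \<open>1 - 2 * c^2\<close> if \<open>c \<le> 13 / 20\<close>: the graph induced on the common neighbours has exactly one or three
    isolated vertices;
  \<^item> \<open>\<bar>4 * c^2 / (1 + c) - 1\<bar>\<close> if \<open>c \<ge> 1 / 2\<close>: there is a common neighbour \<open>p\<close> such that exactly one line is
    adjacent to \<open>p\<close>, \<open>x\<close> and \<open>y\<close>;
  \<^item> \<open>1 - (1 - c) / (4 * c^2)\<close> if \<open>c > 81 / 100\<close>: \<open>x\<close> and \<open>y\<close> are the midpoints of two sides of an isosceles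
    triangle whose base and half sides have angular length \<open>arccos c\<close>.

  The first three lead from any \<open>c\<close> to a value above \<open>81 / 100\<close>, and iterating the last one gives
  arbitrarily small preserved angles. Chains of such small steps show that \<open>f\<close> does not increase
  angles; the same holds for its inverse, so \<open>f\<close> preserves all angles and the theorem becomes Wigner's.\<close>

subsection \<open>Configurations of unit vectors\<close>

lemma unit_inner_eq_1:
  fixes x y :: "'a::real_inner"
  assumes "x \<bullet> x = 1" "y \<bullet> y = 1" "x \<bullet> y = 1"
  shows "x = y"
proof -
  have "(x - y) \<bullet> (x - y) = 0"
    using assms by (simp add: inner_diff inner_commute)
  then show ?thesis by simp
qed

lemma unit_abs_inner_eq_1:
  fixes x y :: "'a::real_inner"
  assumes "x \<bullet> x = 1" "y \<bullet> y = 1"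
  shows "\<bar>x \<bullet> y\<bar> = 1 \<longleftrightarrow> y = x \<or> y = - x"
  using assms unit_inner_eq_1[of x y] unit_inner_eq_1[of "x" "-y"] by (auto simp: abs_if split: if_splits)

lemma unit_inner_le_1:
  fixes x y :: "'a::real_inner"
  assumes "x \<bullet> x = 1" "y \<bullet> y = 1"
  shows "\<bar>x \<bullet> y\<bar> \<le> 1"
  using Cauchy_Schwarz_ineq2[of x y] assms by (simp add: norm_eq_sqrt_inner)

text \<open>A line has two opposite unit vectors. The one with nonnegative inner product with
  \<open>x\<close> is taken, and the last two facts let it replace \<open>y\<close> under absolute
  values.\<close>

lemma flip_sign:
  fixes x y :: "'a::real_inner"
  assumes "\<bar>x \<bullet> y\<bar> = c"
  obtains z where "z = y \<or> z = - y" "x \<bullet> z = c" "z \<bullet> z = y \<bullet> y" "\<And>w. \<bar>z \<bullet> w\<bar> = \<bar>y \<bullet> w\<bar>" "\<And>w. \<bar>w \<bullet> z\<bar> = \<bar>w \<bullet> y\<bar>"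
  using assms that[of y] that[of "- y"] by (auto simp: abs_if split: if_splits)

text \<open>For orthogonal \<open>a\<close> and \<open>b\<close> this is the reflection fixing \<open>span {a, b}\<close> pointwise and negating its
  orthogonal complement; a zero vector among \<open>a\<close>, \<open>b\<close> is harmless because of \<open>x / 0 = 0\<close>. Uniqueness of a point
  in an invariant configuration forces it into that span.\<close>

definition mirror :: "'a::real_inner \<Rightarrow> 'a \<Rightarrow> 'a \<Rightarrow> 'a" where
  "mirror a b v = (2 * (v \<bullet> a) / (a \<bullet> a)) *\<^sub>R a + (2 * (v \<bullet> b) / (b \<bullet> b)) *\<^sub>R b - v"

lemma inner_mirror:
  "mirror a b v \<bullet> w = 2 * (v \<bullet> a) * (w \<bullet> a) / (a \<bullet> a) + 2 * (v \<bullet> b) * (w \<bullet> b) / (b \<bullet> b) - v \<bullet> w"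
  by (simp add: mirror_def inner_simps inner_commute)

lemma mirror_adjoint: "mirror a b v \<bullet> w = v \<bullet> mirror a b w"
  using inner_commute[of v "mirror a b w"] inner_commute[of v w] by (simp add: inner_mirror mult_ac)

lemma mirror_fixes:
  assumes "a \<bullet> b = 0" shows "mirror a b a = a" "mirror a b b = b"
  using assms inner_commute[of a b] by (auto simp: mirror_def scaleR_2)

lemma mirror_mirror:
  assumes "a \<bullet> b = 0" shows "mirror a b (mirror a b v) = v"
proof -
  have m: "mirror a b v \<bullet> a = v \<bullet> a" "mirror a b v \<bullet> b = v \<bullet> b"
    by (simp_all add: mirror_adjoint mirror_fixes[OF assms])
  show ?thesis unfolding mirror_def[of a b "mirror a b v"] m by (simp add: mirror_def)
qed

lemma mirror_isometry:
  assumes "a \<bullet> b = 0" shows "mirror a b v \<bullet> mirror a b w = v \<bullet> w"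
  by (simp add: mirror_adjoint mirror_mirror[OF assms])

text \<open>For unit vectors, \<open>x + y\<close> and \<open>x - y\<close> are orthogonal and have
  the same span as \<open>x\<close> and \<open>y\<close>. This saves a Gram-Schmidt step and covers
  \<open>y = x\<close> and \<open>y = - x\<close>.\<close>

lemma mirror_plane:
  fixes x y :: "'a::real_inner"
  assumes "x \<bullet> x = 1" "y \<bullet> y = 1"
  defines "S \<equiv> mirror (x + y) (x - y)"
  shows "S v \<bullet> x = v \<bullet> x" "S v \<bullet> y = v \<bullet> y" "S v \<bullet> S w = v \<bullet> w" "S (S v) = v"
    "S v \<bullet> w = v \<bullet> S w"
proof -
  have o: "(x + y) \<bullet> (x - y) = 0"
    using assms by (simp add: inner_simps inner_commute)
  show "S v \<bullet> S w = v \<bullet> w" "S (S v) = v" "S v \<bullet> w = v \<bullet> S w"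
    unfolding S_def by (simp_all add: mirror_isometry mirror_mirror o mirror_adjoint)
  have "S v \<bullet> (x + y) = v \<bullet> (x + y)" "S v \<bullet> (x - y) = v \<bullet> (x - y)"
    unfolding S_def by (simp_all only: mirror_adjoint mirror_fixes[OF o])
  then show "S v \<bullet> x = v \<bullet> x" "S v \<bullet> y = v \<bullet> y"
    by (simp_all add: inner_simps)
qed

text \<open>As \<open>p\<close> is orthogonal to \<open>x - y\<close>, its inner product with its
  mirror image is \<open>8 * c^2 / M - 1\<close>, where \<open>M\<close> is the squared norm of
  \<open>x + y\<close>. This exceeds \<open>- 1\<close>, so it is \<open>1\<close>, which determines
  \<open>M\<close>.\<close>

lemma mirror_fixed_neighbour:
  fixes x y p :: "'a::real_inner"
  assumes "x \<bullet> x = 1" "y \<bullet> y = 1" "p \<bullet> p = 1" and c: "p \<bullet> x = c" "p \<bullet> y = c" "c > 0"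
    and S: "\<bar>mirror (x + y) (x - y) p \<bullet> p\<bar> = 1"
  shows "x \<bullet> y = 2 * c^2 - 1"
proof -
  define M where "M = (x + y) \<bullet> (x + y)"
  have M: "M = 2 + 2 * (x \<bullet> y)"
    using assms by (simp add: M_def inner_simps inner_commute)
  have pm: "p \<bullet> (x + y) = 2 * c" "p \<bullet> (x - y) = 0"
    using c by (simp_all add: inner_simps)
  then have "x + y \<noteq> 0" using c by auto
  then have "M > 0" by (simp add: M_def)
  have "\<bar>8 * c^2 / M - 1\<bar> = 1"
    using S assms(3) by (simp add: inner_mirror pm M_def[symmetric] power2_eq_square)
  moreover have "8 * c^2 / M > 0" using c \<open>M > 0\<close> by simp
  ultimately have "8 * c^2 / M = 2" by linarith
  then have "M = 4 * c^2" using \<open>M > 0\<close> by (simp add: field_simps)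
  with M show ?thesis by simp
qed

text \<open>\<open>z\<close> is \<open>(c / (1 + t)) (x + y)\<close> plus a multiple of a unit
  normal \<open>e\<close>. The hypothesis says that the squared norm
  \<open>2 * c^2 / (1 + t)\<close> of the first part is at most 1.\<close>

lemma common_neighbour:
  fixes x y :: "'a::real_inner"
  assumes D: "\<And>a b::'a. \<exists>e. e \<bullet> e = 1 \<and> e \<bullet> a = 0 \<and> e \<bullet> b = 0"
    and u: "x \<bullet> x = 1" "y \<bullet> y = 1" and c: "2 * c^2 \<le> 1 + x \<bullet> y" "c > 0"
  obtains z where "z \<bullet> z = 1" "z \<bullet> x = c" "z \<bullet> y = c"
proof -
  obtain e where e: "e \<bullet> e = 1" "e \<bullet> x = 0" "e \<bullet> y = 0"
    using D by blast
  define t where "t = x \<bullet> y"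
  define h where "h = sqrt (1 - 2 * c^2 / (1 + t))"
  have t: "1 + t > 0" using c zero_less_power[of c 2] unfolding t_def by linarith
  have "2 * c^2 / (1 + t) \<le> 1" using c t by (simp add: t_def field_simps)
  then have h: "h * h = 1 - 2 * c^2 / (1 + t)" by (simp add: h_def)
  define z where "z = (c / (1 + t)) *\<^sub>R (x + y) + h *\<^sub>R e"
  have yx: "y \<bullet> x = t" "x \<bullet> y = t" by (simp_all add: t_def inner_commute)
  have ee: "x \<bullet> e = 0" "y \<bullet> e = 0" using e by (simp_all add: inner_commute)
  have "z \<bullet> x = c / (1 + t) * (1 + t)" "z \<bullet> y = c / (1 + t) * (1 + t)"
    by (simp_all add: z_def inner_simps u yx e ee algebra_simps add_divide_distrib)
  then have zx: "z \<bullet> x = c" "z \<bullet> y = c"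
    using t by simp_all
  have ze: "z \<bullet> e = h" by (simp add: z_def inner_simps e ee)
  have "z \<bullet> z = (c / (1 + t)) * (z \<bullet> x + z \<bullet> y) + h * (z \<bullet> e)"
    by (subst (2) z_def) (simp add: inner_simps)
  also have "\<dots> = 1" by (simp add: zx ze h power2_eq_square)
  finally show thesis using that zx by blast
qed

section \<open>Pairs with a unique common neighbour\<close>

text \<open>The mirror in the span of \<open>x\<close> and \<open>y\<close> permutes their common
  neighbours, so it fixes the line of the only one. Signs are first adjusted to make both inner
  products with \<open>z\<close> equal to \<open>c\<close>.\<close>

lemma unique_neighbour_dist:
  fixes x y z :: "'a::real_inner"
  assumes "x \<bullet> x = 1" "y \<bullet> y = 1" "z \<bullet> z = 1" and c: "\<bar>z \<bullet> x\<bar> = c" "\<bar>z \<bullet> y\<bar> = c" "c > 0"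
    and "\<And>w. w \<bullet> w = 1 \<Longrightarrow> \<bar>w \<bullet> x\<bar> = c \<Longrightarrow> \<bar>w \<bullet> y\<bar> = c \<Longrightarrow> \<bar>w \<bullet> z\<bar> = 1"
  shows "\<bar>x \<bullet> y\<bar> = \<bar>2 * c^2 - 1\<bar>"
proof -
  obtain x' where x': "z \<bullet> x' = c" "x' \<bullet> x' = x \<bullet> x" "\<And>w. \<bar>x' \<bullet> w\<bar> = \<bar>x \<bullet> w\<bar>" "\<And>w. \<bar>w \<bullet> x'\<bar> = \<bar>w \<bullet> x\<bar>"
    using flip_sign[OF c(1)] by metis
  obtain y' where y': "z \<bullet> y' = c" "y' \<bullet> y' = y \<bullet> y" "\<And>w. \<bar>y' \<bullet> w\<bar> = \<bar>y \<bullet> w\<bar>" "\<And>w. \<bar>w \<bullet> y'\<bar> = \<bar>w \<bullet> y\<bar>"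
    using flip_sign[OF c(2)] by metis
  note u = x'(2)[unfolded assms] y'(2)[unfolded assms]
  let ?S = "mirror (x' + y') (x' - y')"
  have "\<bar>?S z \<bullet> z\<bar> = 1"
  proof (rule assms(7))
    show "?S z \<bullet> ?S z = 1" using mirror_plane(3)[OF u] assms(3) by simp
    have "\<bar>?S z \<bullet> x'\<bar> = c" "\<bar>?S z \<bullet> y'\<bar> = c"
      using mirror_plane(1,2)[OF u] x'(1) y'(1) c(3) by simp_all
    then show "\<bar>?S z \<bullet> x\<bar> = c" "\<bar>?S z \<bullet> y\<bar> = c" by (simp_all only: x'(4) y'(4))
  qed
  from mirror_fixed_neighbour[OF u assms(3) x'(1) y'(1) c(3) this] show ?thesis
    using x' y' by metis
qed

text \<open>The neighbour is the normalised midpoint of the two vectors, with signs chosen so that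
  their angle is acute.\<close>

lemma unique_neighbour_ex:
  fixes x y :: "'a::real_inner"
  assumes u: "x \<bullet> x = 1" "y \<bullet> y = 1" and c: "c > 0" "2 * c^2 > 1" and t: "\<bar>x \<bullet> y\<bar> = 2 * c^2 - 1"
  obtains z where "z \<bullet> z = 1" "\<bar>z \<bullet> x\<bar> = c" "\<bar>z \<bullet> y\<bar> = c"
    "\<And>w. w \<bullet> w = 1 \<Longrightarrow> \<bar>w \<bullet> x\<bar> = c \<Longrightarrow> \<bar>w \<bullet> y\<bar> = c \<Longrightarrow> \<bar>w \<bullet> z\<bar> = 1"
proof -
  obtain y' where y': "x \<bullet> y' = 2 * c^2 - 1" "y' \<bullet> y' = 1" "\<And>w. \<bar>w \<bullet> y'\<bar> = \<bar>w \<bullet> y\<bar>"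
    using flip_sign[OF t] u by metis
  have yx: "y' \<bullet> x = 2 * c^2 - 1" using y' by (simp add: inner_commute)
  define z where "z = (1 / (2 * c)) *\<^sub>R (x + y')"
  have zx: "z \<bullet> x = c" "z \<bullet> y' = c"
    using c by (simp_all add: z_def inner_simps u y' yx field_simps power2_eq_square)
  have zz: "z \<bullet> z = 1"
    using c zx by (subst (2) z_def) (simp add: inner_simps field_simps)
  have main: "\<bar>w \<bullet> z\<bar> = 1" if w: "w \<bullet> w = 1" "\<bar>w \<bullet> x\<bar> = c" "\<bar>w \<bullet> y'\<bar> = c" for w
  proof -
    have eq: "\<bar>w \<bullet> z\<bar> = \<bar>w \<bullet> x + w \<bullet> y'\<bar> / (2 * c)"
      using c by (simp add: z_def inner_simps abs_mult)
    \<comment> \<open>Opposite signs would give \<open>4 * c^2 \<le> 4 - 4 * c^2\<close> by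
      Cauchy-Schwarz, against \<open>2 * c^2 > 1\<close>.\<close>
    have "w \<bullet> x = w \<bullet> y'"
    proof (rule ccontr)
      assume "w \<bullet> x \<noteq> w \<bullet> y'"
      then have "\<bar>w \<bullet> (x - y')\<bar> = 2 * c" using w by (auto simp: inner_simps abs_if split: if_splits)
      then have "4 * c^2 = (w \<bullet> (x - y'))^2"
        by (metis power2_abs four_x_squared)
      also have "\<dots> \<le> (x - y') \<bullet> (x - y')" using Cauchy_Schwarz_ineq[of w "x - y'"] w by simp
      also have "\<dots> = 4 - 4 * c^2" using u y' yx by (simp add: inner_simps)
      finally show False using c by simp
    qed
    then have "\<bar>w \<bullet> x + w \<bullet> y'\<bar> = 2 * c" using w by (auto simp: abs_if split: if_splits)
    with eq c show ?thesis by simp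
  qed
  show thesis
  proof (rule that)
    show "z \<bullet> z = 1" "\<bar>z \<bullet> x\<bar> = c" "\<bar>z \<bullet> y\<bar> = c"
      using zz zx c y'(3)[of z] by simp_all
    show "\<bar>w \<bullet> z\<bar> = 1" if "w \<bullet> w = 1" "\<bar>w \<bullet> x\<bar> = c" "\<bar>w \<bullet> y\<bar> = c" for w
      using main[of w] that y'(3)[of w] by simp
  qed
qed

section \<open>Isolated common neighbours\<close>

definition isolated :: "real \<Rightarrow> 'a::real_inner \<Rightarrow> 'a \<Rightarrow> 'a \<Rightarrow> bool" where
  "isolated c x y p \<longleftrightarrow> p \<bullet> p = 1 \<and> \<bar>p \<bullet> x\<bar> = c \<and> \<bar>p \<bullet> y\<bar> = c \<and>
     (\<forall>q. q \<bullet> q = 1 \<and> \<bar>q \<bullet> x\<bar> = c \<and> \<bar>q \<bullet> y\<bar> = c \<longrightarrow> \<bar>q \<bullet> p\<bar> \<noteq> c)"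

definition one_line :: "('a::real_inner \<Rightarrow> bool) \<Rightarrow> bool" where
  "one_line P \<longleftrightarrow> (\<exists>p. p \<bullet> p = 1 \<and> P p \<and> (\<forall>q. q \<bullet> q = 1 \<and> P q \<longrightarrow> \<bar>q \<bullet> p\<bar> = 1))"

text \<open>The other odd count that can occur: in dimension 3 all three common neighbours may be
  isolated.\<close>

definition three_lines :: "('a::real_inner \<Rightarrow> bool) \<Rightarrow> bool" where
  "three_lines P \<longleftrightarrow> (\<exists>p q r. p \<bullet> p = 1 \<and> q \<bullet> q = 1 \<and> r \<bullet> r = 1 \<and> P p \<and> P q \<and> P r \<and>
     \<bar>p \<bullet> q\<bar> \<noteq> 1 \<and> \<bar>p \<bullet> r\<bar> \<noteq> 1 \<and> \<bar>q \<bullet> r\<bar> \<noteq> 1 \<and>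
     (\<forall>s. s \<bullet> s = 1 \<and> P s \<longrightarrow> \<bar>s \<bullet> p\<bar> = 1 \<or> \<bar>s \<bullet> q\<bar> = 1 \<or> \<bar>s \<bullet> r\<bar> = 1))"

lemma same_line_trans:
  fixes x y z :: "'a::real_inner"
  assumes "x \<bullet> x = 1" "y \<bullet> y = 1" "z \<bullet> z = 1" "\<bar>x \<bullet> y\<bar> = 1" "\<bar>y \<bullet> z\<bar> = 1"
  shows "\<bar>x \<bullet> z\<bar> = 1"
  using assms by (auto simp: unit_abs_inner_eq_1)

text \<open>The orbits of an involution have size one or two, so an odd number of lines cannot be
  permuted without a fixed one.\<close>

lemma involution_fixes_line:
  fixes S :: "'a::real_inner \<Rightarrow> 'a"
  assumes P: "one_line P \<or> three_lines P"
    and PS: "\<And>p. p \<bullet> p = 1 \<Longrightarrow> P p \<Longrightarrow> P (S p)"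
    and S: "\<And>v w. S v \<bullet> S w = v \<bullet> w" "\<And>v. S (S v) = v"
  obtains p where "p \<bullet> p = 1" "P p" "\<bar>S p \<bullet> p\<bar> = 1"
proof -
  have sw: "S v \<bullet> w = S w \<bullet> v" for v w
    using S by (metis inner_commute)
  from P show thesis
  proof
    assume "one_line P"
    then obtain p where "p \<bullet> p = 1" "P p" "\<And>q. q \<bullet> q = 1 \<Longrightarrow> P q \<Longrightarrow> \<bar>q \<bullet> p\<bar> = 1"
      unfolding one_line_def by blast
    then show thesis using that[of p] PS[of p] S by simp
  next
    assume "three_lines P"
    then obtain p q r where u: "p \<bullet> p = 1" "q \<bullet> q = 1" "r \<bullet> r = 1" and P: "P p" "P q" "P r"
      and ne: "\<bar>p \<bullet> q\<bar> \<noteq> 1" "\<bar>p \<bullet> r\<bar> \<noteq> 1" "\<bar>q \<bullet> r\<bar> \<noteq> 1"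
      and all: "\<And>s. s \<bullet> s = 1 \<Longrightarrow> P s \<Longrightarrow> \<bar>s \<bullet> p\<bar> = 1 \<or> \<bar>s \<bullet> q\<bar> = 1 \<or> \<bar>s \<bullet> r\<bar> = 1"
      unfolding three_lines_def by blast
    have Su: "S p \<bullet> S p = 1" "S q \<bullet> S q = 1" "S r \<bullet> S r = 1"
      by (simp_all add: S u)
    have cases: "\<bar>S p \<bullet> p\<bar> = 1 \<or> \<bar>S p \<bullet> q\<bar> = 1 \<or> \<bar>S p \<bullet> r\<bar> = 1"
      "\<bar>S q \<bullet> p\<bar> = 1 \<or> \<bar>S q \<bullet> q\<bar> = 1 \<or> \<bar>S q \<bullet> r\<bar> = 1"
      "\<bar>S r \<bullet> p\<bar> = 1 \<or> \<bar>S r \<bullet> q\<bar> = 1 \<or> \<bar>S r \<bullet> r\<bar> = 1"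
      using all PS Su u P by blast+
    have excl: "\<not> (\<bar>S v \<bullet> a\<bar> = 1 \<and> \<bar>S v \<bullet> b\<bar> = 1)"
      if "v \<bullet> v = 1" "a \<bullet> a = 1" "b \<bullet> b = 1" "\<bar>a \<bullet> b\<bar> \<noteq> 1" for v a b
      using same_line_trans[of a "S v" b] that S(1)[of v v] by (auto simp: inner_commute)
    \<comment> \<open>Without a fixed line, \<open>excl\<close> and the symmetry \<open>sw\<close>
      would pair off the three lines.\<close>
    have "\<bar>S p \<bullet> p\<bar> = 1 \<or> \<bar>S q \<bullet> q\<bar> = 1 \<or> \<bar>S r \<bullet> r\<bar> = 1"
      using cases excl[of p q r] excl[of q p r] excl[of r p q] u ne sw[of p q] sw[of p r] sw[of q r]
      by metis
    then show thesis using that u P by blast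
  qed
qed

lemma isolated_uminus:
  "isolated c x (- y) = isolated c x y"
  "isolated c x y (- p) = isolated c x y p"
  by (auto simp: isolated_def fun_eq_iff)

text \<open>The mirror in the span of \<open>x\<close> and \<open>y\<close> permutes the isolated
  common neighbours. Their number being odd, it fixes the line of one of them, to which
  \<open>mirror_fixed_neighbour\<close> applies.\<close>

lemma isolated_odd_dist:
  fixes x y :: "'a::real_inner"
  assumes u: "x \<bullet> x = 1" "y \<bullet> y = 1" and c: "c > 0"
    and "one_line (isolated c x y) \<or> three_lines (isolated c x y)"
  shows "\<bar>x \<bullet> y\<bar> = \<bar>2 * c^2 - 1\<bar>"
proof -
  let ?S = "mirror (x + y) (x - y)"
  note S = mirror_plane[OF u]
  have "isolated c x y (?S p)" if "isolated c x y p" for p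
    unfolding isolated_def
  proof (intro conjI allI impI)
    fix q assume q: "q \<bullet> q = 1 \<and> \<bar>q \<bullet> x\<bar> = c \<and> \<bar>q \<bullet> y\<bar> = c"
    then have "\<bar>?S q \<bullet> p\<bar> \<noteq> c" using that S unfolding isolated_def by metis
    then show "\<bar>q \<bullet> ?S p\<bar> \<noteq> c" using S by metis
  qed (use that S in \<open>auto simp: isolated_def\<close>)
  then obtain p where p: "p \<bullet> p = 1" "isolated c x y p" "\<bar>?S p \<bullet> p\<bar> = 1"
    using involution_fixes_line[of "isolated c x y" ?S] assms(4) S by metis
  have px: "\<bar>p \<bullet> x\<bar> = c" "\<bar>p \<bullet> y\<bar> = c" using p by (auto simp: isolated_def)
  show ?thesis
  proof (cases "p \<bullet> x = p \<bullet> y")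
    case True
    have "mirror (x + y) (x - y) (- p) \<bullet> - p = ?S p \<bullet> p"
      by (simp add: inner_mirror)
    then show ?thesis
      using mirror_fixed_neighbour[OF u p(1) _ _ c p(3)] mirror_fixed_neighbour[OF u, of "-p" c] True p px c
      by (auto simp: abs_if split: if_splits)
  next
    case False
    have u': "(-y) \<bullet> (-y) = 1" using u by simp
    \<comment> \<open>Replacing \<open>y\<close> by \<open>- y\<close> only exchanges the two axes
      of the mirror.\<close>
    have "mirror (x + -y) (x - -y) p \<bullet> p = ?S p \<bullet> p" "mirror (x + -y) (x - -y) (- p) \<bullet> - p = ?S p \<bullet> p"
      by (simp_all add: inner_mirror)
    then have "x \<bullet> -y = 2 * c^2 - 1"
      using mirror_fixed_neighbour[OF u(1) u', of "p" c] mirror_fixed_neighbour[OF u(1) u', of "-p" c] False p px c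
      by (auto simp: abs_if split: if_splits)
    then show ?thesis by simp
  qed
qed

text \<open>If \<open>x \<bullet> y = 2 * c^2 - 1\<close>, then \<open>p = (x + y) / (2 * c)\<close> is isolated, and the other common
  neighbours are \<open>d + v\<close> with \<open>d\<close> fixed and \<open>v\<close> on a sphere orthogonal to \<open>x\<close> and \<open>y\<close>. In
  dimension at least 4 none of these is isolated; in dimension 3 there are just two of them.\<close>

lemma isolated_odd_ex:
  fixes x y :: "'a::real_inner"
  assumes D: "\<And>a b::'a. \<exists>e. e \<bullet> e = 1 \<and> e \<bullet> a = 0 \<and> e \<bullet> b = 0"
    and u: "x \<bullet> x = 1" "y \<bullet> y = 1" and c: "c > 0" "2 * c^2 < 1" "2 * c^2 \<le> (1 + c) * (1 - c^2)"
    and t: "\<bar>x \<bullet> y\<bar> = 1 - 2 * c^2"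
  shows "one_line (isolated c x y) \<or> three_lines (isolated c x y)"
proof -
  have main: "one_line (isolated c x y) \<or> three_lines (isolated c x y)"
    if u: "x \<bullet> x = 1" "y \<bullet> y = 1" and t: "x \<bullet> y = 2 * c^2 - 1" for x y :: 'a
  proof -
    have yx: "y \<bullet> x = 2 * c^2 - 1" using t by (simp add: inner_commute)
    have "1 \<le> c^2" if "1 \<le> c" using that by (rule one_le_power)
    then have c1: "c < 1" using c by linarith
    define p where "p = (1 / (2 * c)) *\<^sub>R (x + y)"
    have px: "p \<bullet> x = c" "p \<bullet> y = c"
      using c by (simp_all add: p_def inner_simps u t yx field_simps power2_eq_square)
    have pp: "p \<bullet> p = 1"
      using c px by (subst (2) p_def) (simp add: inner_simps field_simps)
    have wp: "w \<bullet> p = (w \<bullet> x + w \<bullet> y) / (2 * c)" for w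
      using c by (simp add: p_def inner_simps)
    define s where "s = 1 - c^2"
    \<comment> \<open>The vector of the plane with inner products \<open>c\<close> and
      \<open>- c\<close> with \<open>x\<close> and \<open>y\<close>; its squared norm is
      \<open>k\<close> below.\<close>
    define d where "d = (c / (2 * s)) *\<^sub>R (x - y)"
    have s: "s > 0" "s > c^2" "s = 1 - c^2" using c by (auto simp: s_def)
    have dx: "d \<bullet> x = c" "d \<bullet> y = - c"
      using s(1) by (simp_all add: d_def inner_simps u t yx field_simps) (simp_all add: s(3) algebra_simps)
    have wd: "w \<bullet> d = c / (2 * s) * (w \<bullet> x - w \<bullet> y)" for w
      by (simp add: d_def inner_simps)
    have dd: "d \<bullet> d = c^2 / s" by (subst wd) (simp add: dx power2_eq_square)
    define k where "k = c^2 / s"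
    have k: "0 < k" "k < 1" using s c by (auto simp: k_def)
    \<comment> \<open>A restatement of the third condition on \<open>c\<close>; it gives
      \<open>- 1 \<le> r\<close> for the cosine \<open>r\<close> chosen below.\<close>
    have kc: "2 * k \<le> 1 + c" using c s(1) by (simp add: k_def field_simps) (simp add: s(3) algebra_simps)
    have split: "\<bar>q \<bullet> p\<bar> = 1 \<or> (\<exists>v. v \<bullet> x = 0 \<and> v \<bullet> y = 0 \<and> v \<bullet> v = 1 - k \<and> (q = d + v \<or> q = - (d + v)))"
      if q: "q \<bullet> q = 1" "\<bar>q \<bullet> x\<bar> = c" "\<bar>q \<bullet> y\<bar> = c" for q
    proof (cases "q \<bullet> x = q \<bullet> y")
      case True
      then have "\<bar>q \<bullet> p\<bar> = 1" using q c by (simp add: wp abs_mult)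
      then show ?thesis ..
    next
      case False
      then have "q \<bullet> x = c \<and> q \<bullet> y = - c \<or> q \<bullet> x = - c \<and> q \<bullet> y = c"
        using q by (auto simp: abs_if split: if_splits)
      then obtain q' where q': "q' = q \<or> q' = - q" "q' \<bullet> x = c" "q' \<bullet> y = - c" "q' \<bullet> q' = 1"
        using that[of q] that[of "-q"] q(1) by (metis inner_minus_left inner_minus_right minus_minus)
      have q'd: "q' \<bullet> d = k" "d \<bullet> q' = k"
        using q' wd[of q'] by (simp_all add: k_def power2_eq_square inner_commute)
      define v where "v = q' - d"
      have "v \<bullet> x = 0" "v \<bullet> y = 0" using q' dx by (simp_all add: v_def inner_simps)
      moreover have "v \<bullet> v = 1 - k" using q' q'd dd by (simp add: v_def inner_simps k_def)
      moreover have "q = d + v \<or> q = - (d + v)" using q' by (auto simp: v_def)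
      ultimately show ?thesis by blast
    qed
    have nb: "(d + v) \<bullet> (d + v) = 1" "(d + v) \<bullet> x = c" "(d + v) \<bullet> y = - c" "(d + v) \<bullet> p = 0"
      if "v \<bullet> x = 0" "v \<bullet> y = 0" "v \<bullet> v = 1 - k" for v
    proof -
      show a: "(d + v) \<bullet> x = c" "(d + v) \<bullet> y = - c" using that dx by (simp_all add: inner_simps)
      then show "(d + v) \<bullet> p = 0" by (simp add: wp)
      have "v \<bullet> d = 0" "d \<bullet> v = 0" using that wd[of v] by (simp_all add: inner_commute)
      then show "(d + v) \<bullet> (d + v) = 1" using that dd by (simp add: inner_simps k_def)
    qed
    \<comment> \<open>Every other common neighbour is orthogonal to \<open>p\<close>, and neither
      \<open>0\<close> nor \<open>1\<close> equals \<open>c\<close>.\<close>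
    have ip: "isolated c x y p"
      unfolding isolated_def
    proof (intro conjI allI impI)
      fix q assume q: "q \<bullet> q = 1 \<and> \<bar>q \<bullet> x\<bar> = c \<and> \<bar>q \<bullet> y\<bar> = c"
      then consider "\<bar>q \<bullet> p\<bar> = 1" | v where "v \<bullet> x = 0" "v \<bullet> y = 0" "v \<bullet> v = 1 - k" "q = d + v \<or> q = - (d + v)"
        using split by blast
      then show "\<bar>q \<bullet> p\<bar> \<noteq> c"
      proof cases
        case (2 v)
        then have "\<bar>q \<bullet> p\<bar> = 0" using nb(4)[of v] by (metis abs_zero inner_minus_left minus_zero)
        then show ?thesis using c by simp
      qed (use c1 in simp)
    qed (use pp px c in auto)
    \<comment> \<open>The case condition says that the orthogonal complement of \<open>x\<close> and
      \<open>y\<close> has dimension at least 2.\<close>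
    show ?thesis
    proof (cases "\<forall>v. v \<bullet> x = 0 \<and> v \<bullet> y = 0 \<longrightarrow> (\<exists>e. e \<bullet> e = 1 \<and> e \<bullet> x = 0 \<and> e \<bullet> y = 0 \<and> e \<bullet> v = 0)")
      case True
      have "\<not> isolated c x y (d + v)" if v: "v \<bullet> x = 0" "v \<bullet> y = 0" "v \<bullet> v = 1 - k" for v
      proof -
        obtain e where e: "e \<bullet> e = 1" "e \<bullet> x = 0" "e \<bullet> y = 0" "e \<bullet> v = 0" using True v by blast
        \<comment> \<open>The cosine between \<open>v\<close> and the vector \<open>w\<close> to be
          built, obtained by solving \<open>k + r * (1 - k) = c\<close>; then \<open>d + w\<close>
          is adjacent to \<open>d + v\<close>.\<close>
        define r where "r = (c - k) / (1 - k)"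
        have r: "\<bar>r\<bar> \<le> 1" using k kc c c1 by (auto simp: r_def abs_le_iff field_simps)
        then have r2: "r^2 \<le> 1" by (simp add: abs_square_le_1)
        define h where "h = sqrt ((1 - r^2) * (1 - k))"
        have h: "h * h = (1 - r^2) * (1 - k)" using r2 k by (simp add: h_def)
        define w where "w = r *\<^sub>R v + h *\<^sub>R e"
        have w: "w \<bullet> x = 0" "w \<bullet> y = 0" "w \<bullet> v = c - k"
          using v e k by (simp_all add: w_def inner_simps r_def)
        have ve: "v \<bullet> e = 0" using e by (simp add: inner_commute)
        have "w \<bullet> w = r * r * (1 - k) + h * h"
          using v e ve by (simp add: w_def inner_simps)
        then have ww: "w \<bullet> w = 1 - k" unfolding h by (simp add: algebra_simps power2_eq_square)
        have "d \<bullet> v = 0" "w \<bullet> d = 0" "d \<bullet> w = 0" using v w wd[of v] wd[of w] by (simp_all add: inner_commute)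
        then have "(d + w) \<bullet> (d + v) = c" using dd w by (simp add: inner_simps k_def)
        then show ?thesis using nb[OF w(1,2) ww] c unfolding isolated_def
          by (metis abs_minus_cancel abs_of_pos)
      qed
      then have "\<bar>q \<bullet> p\<bar> = 1" if "isolated c x y q" for q
        using split[of q] that isolated_uminus(2)[of c x y q] unfolding isolated_def[of c x y q]
        by (metis minus_minus that)
      then have "one_line (isolated c x y)" unfolding one_line_def using ip pp by blast
      then show ?thesis ..
    next
      case False
      then obtain v0 where v0: "v0 \<bullet> x = 0" "v0 \<bullet> y = 0"
        and none: "\<And>e. e \<bullet> e = 1 \<Longrightarrow> e \<bullet> x = 0 \<Longrightarrow> e \<bullet> y = 0 \<Longrightarrow> e \<bullet> v0 \<noteq> 0" by blast
      obtain e where e: "e \<bullet> e = 1" "e \<bullet> x = 0" "e \<bullet> y = 0" using D by blast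
      define v where "v = sqrt (1 - k) *\<^sub>R e"
      have v: "v \<bullet> x = 0" "v \<bullet> y = 0" "v \<bullet> v = 1 - k" using e k by (simp_all add: v_def)
      \<comment> \<open>The orthogonal complement of \<open>x\<close> and \<open>y\<close> is now a
        line: the combination \<open>z\<close> of \<open>w\<close> and \<open>e\<close> is
        orthogonal to \<open>v0\<close>, so it vanishes by \<open>none\<close>.\<close>
      have only: "w = v \<or> w = - v" if w: "w \<bullet> x = 0" "w \<bullet> y = 0" "w \<bullet> w = 1 - k" for w
      proof -
        define z where "z = (e \<bullet> v0) *\<^sub>R w - (w \<bullet> v0) *\<^sub>R e"
        have "z = 0"
        proof (rule ccontr)
          assume "z \<noteq> 0"
          then have "(1 / norm z) *\<^sub>R z \<bullet> (1 / norm z) *\<^sub>R z = 1"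
            by (simp add: power2_norm_eq_inner[symmetric] power2_eq_square)
          from none[OF this] show False using w e by (simp add: z_def inner_simps)
        qed
        then have "(1 / (e \<bullet> v0)) *\<^sub>R (e \<bullet> v0) *\<^sub>R w = (1 / (e \<bullet> v0)) *\<^sub>R (w \<bullet> v0) *\<^sub>R e"
          by (simp add: z_def)
        then have "w = ((w \<bullet> v0) / (e \<bullet> v0)) *\<^sub>R e"
          using none[OF e] by simp
        then obtain a where a: "w = a *\<^sub>R e" by blast
        with w e have "a^2 = (sqrt (1 - k))^2" using k by (simp add: power2_eq_square)
        then have "a = sqrt (1 - k) \<or> a = - sqrt (1 - k)" by (simp add: power2_eq_iff)
        then show ?thesis by (auto simp: a v_def)
      qed
      have mv: "(-v) \<bullet> x = 0" "(-v) \<bullet> y = 0" "(-v) \<bullet> (-v) = 1 - k" using v by auto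
      have dv: "d \<bullet> v = 0" "v \<bullet> d = 0" using v wd[of v] by (simp_all add: inner_commute)
      note nb1 = nb[OF v] and nb2 = nb[OF mv]
      have all: "\<bar>q \<bullet> p\<bar> = 1 \<or> \<bar>q \<bullet> (d + v)\<bar> = 1 \<or> \<bar>q \<bullet> (d + - v)\<bar> = 1"
        if "q \<bullet> q = 1" "\<bar>q \<bullet> x\<bar> = c" "\<bar>q \<bullet> y\<bar> = c" for q
        using split[OF that] only nb1(1) nb2(1)
        by (metis abs_minus_cancel abs_one inner_minus_left)
      have n12: "(d + v) \<bullet> (d + - v) = 2 * k - 1"
        using dd v dv by (simp add: inner_simps k_def)
      have cp: "\<bar>q \<bullet> (d + v)\<bar> = c \<Longrightarrow> \<bar>q \<bullet> (d + - v)\<bar> = 1"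
        "\<bar>q \<bullet> (d + - v)\<bar> = c \<Longrightarrow> \<bar>q \<bullet> (d + v)\<bar> = 1"
        if "q \<bullet> q = 1" "\<bar>q \<bullet> x\<bar> = c" "\<bar>q \<bullet> y\<bar> = c" for q
      proof -
        have "q = p \<or> q = - p \<or> q = d + v \<or> q = - (d + v) \<or> q = d + - v \<or> q = - (d + - v)"
          using split[OF that] only unit_abs_inner_eq_1[OF that(1) pp] by (metis minus_minus)
        moreover have "p \<bullet> (d + v) = 0" "p \<bullet> (d + - v) = 0" using nb1(4) nb2(4) by (simp_all add: inner_commute)
        ultimately show "\<bar>q \<bullet> (d + v)\<bar> = c \<Longrightarrow> \<bar>q \<bullet> (d + - v)\<bar> = 1"
          "\<bar>q \<bullet> (d + - v)\<bar> = c \<Longrightarrow> \<bar>q \<bullet> (d + v)\<bar> = 1"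
          using nb1(1) nb2(1) c c1 by (metis abs_minus_cancel abs_one abs_zero inner_minus_left less_irrefl)+
      qed
      \<comment> \<open>Since \<open>p\<close> is orthogonal to both, \<open>d + v\<close> and
        \<open>d - v\<close> can only be adjacent to each other; their inner product is
        \<open>2 * k - 1\<close>.\<close>
      have i12: "isolated c x y (d + v) \<longleftrightarrow> \<bar>2 * k - 1\<bar> \<noteq> c" "isolated c x y (d + - v) \<longleftrightarrow> \<bar>2 * k - 1\<bar> \<noteq> c"
      proof -
        have sw: "(d + - v) \<bullet> (d + v) = 2 * k - 1" using n12 by (simp add: inner_commute)
        show "isolated c x y (d + v) \<longleftrightarrow> \<bar>2 * k - 1\<bar> \<noteq> c"
        proof
          show "isolated c x y (d + v) \<Longrightarrow> \<bar>2 * k - 1\<bar> \<noteq> c"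
            using nb2 c sw unfolding isolated_def by (metis abs_minus_cancel abs_of_pos)
          assume k': "\<bar>2 * k - 1\<bar> \<noteq> c"
          have "\<bar>q \<bullet> (d + v)\<bar> \<noteq> c" if q: "q \<bullet> q = 1" "\<bar>q \<bullet> x\<bar> = c" "\<bar>q \<bullet> y\<bar> = c" for q
          proof
            assume a: "\<bar>q \<bullet> (d + v)\<bar> = c"
            from cp(1)[OF q a] have "d + - v = q \<or> d + - v = - q" using unit_abs_inner_eq_1[OF q(1) nb2(1)] by blast
            then have "\<bar>q \<bullet> (d + v)\<bar> = \<bar>2 * k - 1\<bar>" using sw by (metis abs_minus_cancel inner_minus_left)
            with a k' show False by simp
          qed
          then show "isolated c x y (d + v)" using nb1 c unfolding isolated_def by auto
        qed
        show "isolated c x y (d + - v) \<longleftrightarrow> \<bar>2 * k - 1\<bar> \<noteq> c"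
        proof
          show "isolated c x y (d + - v) \<Longrightarrow> \<bar>2 * k - 1\<bar> \<noteq> c"
            using nb1 c n12 unfolding isolated_def by (metis abs_minus_cancel abs_of_pos)
          assume k': "\<bar>2 * k - 1\<bar> \<noteq> c"
          have "\<bar>q \<bullet> (d + - v)\<bar> \<noteq> c" if q: "q \<bullet> q = 1" "\<bar>q \<bullet> x\<bar> = c" "\<bar>q \<bullet> y\<bar> = c" for q
          proof
            assume a: "\<bar>q \<bullet> (d + - v)\<bar> = c"
            from cp(2)[OF q a] have "d + v = q \<or> d + v = - q" using unit_abs_inner_eq_1[OF q(1) nb1(1)] by blast
            then have "\<bar>q \<bullet> (d + - v)\<bar> = \<bar>2 * k - 1\<bar>" using n12 by (metis abs_minus_cancel inner_minus_left)
            with a k' show False by simp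
          qed
          then show "isolated c x y (d + - v)" using nb2 c unfolding isolated_def by auto
        qed
      qed
      have n1: "\<bar>p \<bullet> (d + v)\<bar> \<noteq> 1" "\<bar>p \<bullet> (d + - v)\<bar> \<noteq> 1"
        using nb1(4) nb2(4) by (simp_all add: inner_commute)
      have n2: "\<bar>(d + v) \<bullet> (d + - v)\<bar> \<noteq> 1" using k n12 by auto
      show ?thesis
      \<comment> \<open>If the two are adjacent, \<open>p\<close> alone is isolated; otherwise all
        three are.\<close>
      proof (cases "\<bar>2 * k - 1\<bar> = c")
        case True
        have "\<bar>q \<bullet> p\<bar> = 1" if "isolated c x y q" for q
        proof -
          from that have q: "q \<bullet> q = 1" "\<bar>q \<bullet> x\<bar> = c" "\<bar>q \<bullet> y\<bar> = c" by (auto simp: isolated_def)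
          show ?thesis using all[OF q] that i12 True isolated_uminus(2)[of c x y q]
             unit_abs_inner_eq_1[OF q(1) nb1(1)] unit_abs_inner_eq_1[OF q(1) nb2(1)] by metis
        qed
        then have "one_line (isolated c x y)" unfolding one_line_def using ip pp by blast
        then show ?thesis ..
      next
        case False
        moreover have "\<bar>s \<bullet> p\<bar> = 1 \<or> \<bar>s \<bullet> (d + v)\<bar> = 1 \<or> \<bar>s \<bullet> (d + - v)\<bar> = 1" if "isolated c x y s" for s
          using all[of s] that by (auto simp: isolated_def)
        ultimately have "three_lines (isolated c x y)" unfolding three_lines_def
          using ip pp i12 nb1(1) nb2(1) n1 n2 by blast
        then show ?thesis ..
      qed
    qed
  qed
  show ?thesis
  proof (cases "x \<bullet> y \<le> 0")
    case True
    then show ?thesis using main[of x y] u t by auto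
  next
    case False
    have "isolated c x (-y) = isolated c x y" by (rule isolated_uminus(1))
    then show ?thesis using main[of x "-y"] u t False by auto
  qed
qed

section \<open>Rhombi made of two equilateral triangles\<close>

text \<open>The squared norm of \<open>z - (p - x)\<close> is \<open>3 - 6 * c\<close>. So among
  three mutually adjacent lines this sign pattern occurs only in the planar case of 60
  degrees.\<close>

lemma obtuse_triangle:
  fixes p x z :: "'a::real_inner"
  assumes "p \<bullet> p = 1" "x \<bullet> x = 1" "z \<bullet> z = 1" "p \<bullet> x = c" "z \<bullet> p = c" "z \<bullet> x = - c" "1 / 2 \<le> c"
  shows "c = 1 / 2" "z = p - x"
proof -
  have sw: "x \<bullet> p = c" "p \<bullet> z = c" "x \<bullet> z = - c" using assms by (simp_all add: inner_commute)
  have e: "(z - (p - x)) \<bullet> (z - (p - x)) = 3 - 6 * c"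
    using assms(1-6) sw by (simp add: inner_simps)
  then have "3 - 6 * c \<ge> 0" by (metis inner_ge_zero)
  with assms(7) show c: "c = 1 / 2" by simp
  with e have "z - (p - x) = 0" by simp
  then show "z = p - x" by simp
qed

text \<open>A mirror that fixes \<open>p\<close> and swaps \<open>x\<close> and \<open>y\<close>
  must fix the line of \<open>z\<close> by uniqueness. Then \<open>z\<close> lies in the mirror
  plane, which determines \<open>x \<bullet> y\<close>.\<close>

lemma rhombus_dist:
  fixes x y p z :: "'a::real_inner"
  assumes D: "\<And>a b::'a. \<exists>e. e \<bullet> e = 1 \<and> e \<bullet> a = 0 \<and> e \<bullet> b = 0"
    and u: "x \<bullet> x = 1" "y \<bullet> y = 1" "p \<bullet> p = 1" "z \<bullet> z = 1"
    and c: "1 / 2 \<le> c" "c < 1"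
    and n: "\<bar>p \<bullet> x\<bar> = c" "\<bar>p \<bullet> y\<bar> = c" "\<bar>z \<bullet> p\<bar> = c" "\<bar>z \<bullet> x\<bar> = c" "\<bar>z \<bullet> y\<bar> = c"
    and uniq: "\<And>w. w \<bullet> w = 1 \<Longrightarrow> \<bar>w \<bullet> p\<bar> = c \<Longrightarrow> \<bar>w \<bullet> x\<bar> = c \<Longrightarrow> \<bar>w \<bullet> y\<bar> = c \<Longrightarrow> \<bar>w \<bullet> z\<bar> = 1"
  shows "\<bar>x \<bullet> y\<bar> = \<bar>4 * c^2 / (1 + c) - 1\<bar>"
proof -
  have main: "x \<bullet> y = 4 * c^2 / (1 + c) - 1"
    if u: "x \<bullet> x = 1" "y \<bullet> y = 1" "z \<bullet> z = 1"
    and n: "p \<bullet> x = c" "p \<bullet> y = c" "z \<bullet> p = c" "\<bar>z \<bullet> x\<bar> = c" "\<bar>z \<bullet> y\<bar> = c"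
    and uniq: "\<And>w. w \<bullet> w = 1 \<Longrightarrow> \<bar>w \<bullet> p\<bar> = c \<Longrightarrow> \<bar>w \<bullet> x\<bar> = c \<Longrightarrow> \<bar>w \<bullet> y\<bar> = c \<Longrightarrow> \<bar>w \<bullet> z\<bar> = 1"
    for x y z :: 'a
  proof -
    \<comment> \<open>For \<open>x = y\<close> the common neighbours \<open>w h\<close> and
      \<open>w (- h)\<close> of \<open>p\<close> and \<open>x\<close> would lie on two different
      lines.\<close>
    have xy: "x \<noteq> y"
    proof
      assume eq: "x = y"
      obtain e where e: "e \<bullet> e = 1" "e \<bullet> p = 0" "e \<bullet> x = 0" using D by blast
      have o: "(p + x) \<bullet> (p - x) = 0" using u(1) \<open>p \<bullet> p = 1\<close> by (simp add: inner_simps inner_commute)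
      have se: "p \<bullet> e = 0" "x \<bullet> e = 0" "x \<bullet> p = c" using e n by (simp_all add: inner_commute)
      define k where "k = c / (1 + c)"
      define h where "h = sqrt (1 - 2 * c * k)"
      have k: "k * (1 + c) = c" using c by (simp add: k_def)
      have "2 * c * k < 1"
      proof -
        have "2 * c * c < 1 + c" using mult_pos_neg[of "2 * c + 1" "c - 1"] c by (simp add: algebra_simps)
        then show ?thesis using c by (simp add: k_def field_simps)
      qed
      then have h: "h * h = 1 - 2 * c * k" "h > 0" by (simp_all add: h_def)
      define w where "w s = k *\<^sub>R (p + x) + s *\<^sub>R e" for s
      have wp: "w s \<bullet> p = c" "w s \<bullet> x = c" for s
        using k by (simp_all add: w_def inner_simps u \<open>p \<bullet> p = 1\<close> n e se algebra_simps)
      have we: "w s \<bullet> e = s" for s by (simp add: w_def inner_simps e se)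
      have ww: "w s \<bullet> w s' = 2 * c * k + s * s'" for s s'
        by (subst (2) w_def) (simp add: inner_simps wp we algebra_simps)
      have "\<bar>w h \<bullet> z\<bar> = 1" "\<bar>w (- h) \<bullet> z\<bar> = 1"
        by (rule uniq; use wp ww h c eq in simp)+
      then have "w (- h) = w h \<or> w (- h) = - w h"
        using u(3) ww[of h h] ww[of "-h" "-h"] h unit_abs_inner_eq_1[of "w h" z] unit_abs_inner_eq_1[of "w (-h)" z]
        by auto
      then have "w (- h) \<bullet> e = w h \<bullet> e \<or> w (- h) \<bullet> p = - (w h \<bullet> p)" by auto
      then show False using h c by (simp add: we wp)
    qed
    consider "z \<bullet> x = c" "z \<bullet> y = c" | "z \<bullet> x = - c" "z \<bullet> y = c" | "z \<bullet> x = c" "z \<bullet> y = - c" | "z \<bullet> x = - c" "z \<bullet> y = - c"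
      using n by (auto simp: abs_if split: if_splits)
    then show ?thesis
    proof cases
      case 1
      \<comment> \<open>The sum of the components of \<open>x\<close> and \<open>y\<close>
        orthogonal to \<open>p\<close>. The mirror in \<open>p\<close> and \<open>b\<close> swaps
        \<open>x\<close> and \<open>y\<close>, because it negates \<open>x - y\<close>.\<close>
      define b where "b = x + y - (2 * c) *\<^sub>R p"
      define M where "M = b \<bullet> b"
      have sw: "x \<bullet> p = c" "y \<bullet> p = c" "y \<bullet> x = x \<bullet> y" using n by (simp_all add: inner_commute)
      have pb: "p \<bullet> b = 0" "x \<bullet> b = 1 + x \<bullet> y - 2 * c^2" "y \<bullet> b = 1 + x \<bullet> y - 2 * c^2" "z \<bullet> b = 2 * c - 2 * c^2"
        using u n 1 sw \<open>p \<bullet> p = 1\<close> by (simp_all add: b_def inner_simps power2_eq_square)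
      have M: "M = 2 * (1 + x \<bullet> y - 2 * c^2)"
        unfolding M_def by (subst (1) b_def) (simp add: inner_simps pb)
      have "c * c < c * 1" using c by (intro mult_strict_left_mono) auto
      then have zb: "z \<bullet> b > 0" unfolding pb by (simp add: power2_eq_square)
      then have M0: "M > 0" unfolding M_def by auto
      let ?S = "mirror p b z"
      have S: "?S \<bullet> ?S = 1" using mirror_isometry[OF pb(1)] u by metis
      have Sp: "?S \<bullet> p = c" using mirror_adjoint mirror_fixes[OF pb(1)] n by metis
      have "1 + x \<bullet> y - 2 * c^2 = M / 2" using M by simp
      moreover have "2 * (z \<bullet> b) * (M / 2) / M = z \<bullet> b" using M0 by simp
      ultimately have "2 * (z \<bullet> b) * (1 + x \<bullet> y - 2 * c^2) / M = z \<bullet> b" by (simp only:)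
      then have Sxy: "?S \<bullet> x = c" "?S \<bullet> y = c"
        unfolding inner_mirror M_def[symmetric] pb(1-3) using n sw 1 \<open>p \<bullet> p = 1\<close> pb(4) by (simp_all add: power2_eq_square)
      have "\<bar>?S \<bullet> z\<bar> = 1" using uniq S Sp Sxy c by simp
      moreover have "?S \<bullet> z = 2 * c * c + 2 * (z \<bullet> b) * (z \<bullet> b) / M - 1"
        using n u \<open>p \<bullet> p = 1\<close> by (simp add: inner_mirror M_def)
      moreover have "2 * c * c > 0" "2 * (z \<bullet> b) * (z \<bullet> b) / M > 0" using c zb M0 by simp_all
      ultimately have "(z \<bullet> b) * (z \<bullet> b) / M = 1 - c * c" by linarith
      then have "(2 * c - 2 * c^2) * (2 * c - 2 * c^2) = (1 - c * c) * M" using M0 pb(4) by (simp add: field_simps)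
      then have "(1 - c) * (4 * c^2 * (1 - c)) = (1 - c) * ((1 + c) * M)" by (simp add: algebra_simps power2_eq_square)
      then have "4 * c^2 * (1 - c) = (1 + c) * (2 * (1 + x \<bullet> y - 2 * c^2))" using c M by simp
      then show ?thesis using c by (simp add: field_simps)
    next
      \<comment> \<open>Here \<open>c = 1 / 2\<close> and \<open>x\<close> is orthogonal to
        \<open>y\<close>, so \<open>p - y\<close> is a second common neighbour, orthogonal to
        \<open>z = p - x\<close>. The next case is symmetric.\<close>
      case 2
      note o = obtuse_triangle[OF \<open>p \<bullet> p = 1\<close> u(1,3) n(1,3) 2(1) c(1)]
      have yy: "z \<bullet> y = 1 / 2 - x \<bullet> y" using o n by (simp add: inner_simps)
      then have t: "x \<bullet> y = 0" using 2 o by simp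
      have sw: "x \<bullet> p = 1/2" "y \<bullet> p = 1/2" "p \<bullet> x = 1/2" "p \<bullet> y = 1/2" "y \<bullet> x = 0" "c = 1/2"
        using n t o by (simp_all add: inner_commute)
      have "\<bar>(p - y) \<bullet> z\<bar> = 1"
        by (rule uniq) (simp_all add: inner_simps u sw \<open>p \<bullet> p = 1\<close> t)
      then show ?thesis by (simp add: o(2) inner_simps u sw \<open>p \<bullet> p = 1\<close> t)
    next
      case 3
      note o = obtuse_triangle[OF \<open>p \<bullet> p = 1\<close> u(2,3) n(2,3) 3(2) c(1)]
      have yy: "z \<bullet> x = 1 / 2 - y \<bullet> x" using o n by (simp add: inner_simps)
      then have t: "y \<bullet> x = 0" using 3 o by simp
      have sw: "x \<bullet> p = 1/2" "y \<bullet> p = 1/2" "p \<bullet> x = 1/2" "p \<bullet> y = 1/2" "x \<bullet> y = 0" "c = 1/2"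
        using n t o by (simp_all add: inner_commute)
      have "\<bar>(p - x) \<bullet> z\<bar> = 1"
        by (rule uniq) (simp_all add: inner_simps u sw \<open>p \<bullet> p = 1\<close> t)
      then show ?thesis by (simp add: o(2) inner_simps u sw \<open>p \<bullet> p = 1\<close> t)
    next
      case 4
      then show ?thesis
        using obtuse_triangle[OF \<open>p \<bullet> p = 1\<close> u(1,3) n(1,3) _ c(1)]
          obtuse_triangle[OF \<open>p \<bullet> p = 1\<close> u(2,3) n(2,3) _ c(1)] xy by simp
    qed
  qed
  obtain x' where x': "p \<bullet> x' = c" "x' \<bullet> x' = 1" "\<And>w. \<bar>w \<bullet> x'\<bar> = \<bar>w \<bullet> x\<bar>" "\<And>w. \<bar>x' \<bullet> w\<bar> = \<bar>x \<bullet> w\<bar>"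
    using flip_sign[OF n(1)] u by metis
  obtain y' where y': "p \<bullet> y' = c" "y' \<bullet> y' = 1" "\<And>w. \<bar>w \<bullet> y'\<bar> = \<bar>w \<bullet> y\<bar>"
    using flip_sign[OF n(2)] u by metis
  obtain z' where z': "p \<bullet> z' = c" "z' \<bullet> z' = 1" "\<And>w. \<bar>w \<bullet> z'\<bar> = \<bar>w \<bullet> z\<bar>" "\<And>w. \<bar>z' \<bullet> w\<bar> = \<bar>z \<bullet> w\<bar>"
    using flip_sign[of p z c] n(3) u by (metis inner_commute)
  have "x' \<bullet> y' = 4 * c^2 / (1 + c) - 1"
    by (rule main[of x' y' z']) (use x' y' z' n uniq in \<open>auto simp: inner_commute[of z' p]\<close>)
  then show ?thesis using x'(4) y'(3) by metis
qed

text \<open>The fourth vertex is \<open>z = ((1 + c) / (2 * c)) (x + y) - p\<close>.\<close>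

lemma rhombus_ex:
  fixes x y :: "'a::real_inner"
  assumes D: "\<And>a b::'a. \<exists>e. e \<bullet> e = 1 \<and> e \<bullet> a = 0 \<and> e \<bullet> b = 0"
    and u: "x \<bullet> x = 1" "y \<bullet> y = 1" and c: "1 / 2 \<le> c" "c < 1"
    and t: "\<bar>x \<bullet> y\<bar> = \<bar>4 * c^2 / (1 + c) - 1\<bar>"
  obtains p z where "p \<bullet> p = 1" "z \<bullet> z = 1"
    "\<bar>p \<bullet> x\<bar> = c" "\<bar>p \<bullet> y\<bar> = c" "\<bar>z \<bullet> p\<bar> = c" "\<bar>z \<bullet> x\<bar> = c" "\<bar>z \<bullet> y\<bar> = c"
    "\<And>w. w \<bullet> w = 1 \<Longrightarrow> \<bar>w \<bullet> p\<bar> = c \<Longrightarrow> \<bar>w \<bullet> x\<bar> = c \<Longrightarrow> \<bar>w \<bullet> y\<bar> = c \<Longrightarrow> \<bar>w \<bullet> z\<bar> = 1"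
proof -
  define \<tau> where "\<tau> = 4 * c^2 / (1 + c) - 1"
  \<comment> \<open>As \<open>\<tau>\<close> may be negative, both signs of \<open>y\<close> are
    tried by hand instead of using \<open>flip_sign\<close>.\<close>
  obtain y' where y': "x \<bullet> y' = \<tau>" "y' \<bullet> y' = 1" "\<And>w. \<bar>w \<bullet> y'\<bar> = \<bar>w \<bullet> y\<bar>"
  proof -
    have "y = y \<or> y = -y" "-y = y \<or> -y = -y" by auto
    then show thesis using that[of y] that[of "-y"] t u unfolding \<tau>_def[symmetric] by (auto simp: abs_if split: if_splits)
  qed
  have yx: "y' \<bullet> x = \<tau>" using y' by (simp add: inner_commute)
  have \<tau>: "(1 + \<tau>) * (1 + c) = 4 * c^2" "1 + \<tau> > 0" using c by (simp_all add: \<tau>_def)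
  have fact: "(2 * c + 1) * (c - 1) < 0" using c by (intro mult_pos_neg) auto
  have \<tau>1: "\<tau> < 1" using c fact by (simp add: \<tau>_def field_simps power2_eq_square)
  have "2 * c^2 \<le> 1 + x \<bullet> y'"
  proof -
    have "2 * c^2 * (1 + c) \<le> 2 * c^2 * 2" using c by (intro mult_left_mono) auto
    then have "2 * c^2 * (1 + c) \<le> (1 + \<tau>) * (1 + c)" using \<tau> by simp
    then show ?thesis using c y' by simp
  qed
  then obtain p where p: "p \<bullet> p = 1" "p \<bullet> x = c" "p \<bullet> y' = c"
    using common_neighbour[OF D u(1) y'(2), of c] c by auto
  have xp: "x \<bullet> p = c" "y' \<bullet> p = c" using p by (simp_all add: inner_commute)
  define k where "k = (1 + c) / (2 * c)"
  have k: "2 * c * k = 1 + c" "k * (1 + \<tau>) = 2 * c"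
    using c \<tau> by (simp_all add: k_def field_simps power2_eq_square)
  define z where "z = k *\<^sub>R (x + y') - p"
  have zp: "z \<bullet> p = c" "z \<bullet> x = c" "z \<bullet> y' = c"
    using k by (simp_all add: z_def inner_simps u y' yx xp p algebra_simps)
  have wz: "w \<bullet> z = k * (w \<bullet> x + w \<bullet> y') - w \<bullet> p" for w
    by (simp add: z_def inner_simps)
  have zz: "z \<bullet> z = 1" using k by (simp add: wz zp algebra_simps)
  have pos: "w \<bullet> z = 1" if w: "w \<bullet> w = 1" "w \<bullet> p = c" "\<bar>w \<bullet> x\<bar> = c" "\<bar>w \<bullet> y'\<bar> = c" for w
  proof -
    \<comment> \<open>Otherwise \<open>c = 1 / 2\<close> and \<open>w = p - y'\<close>, so
      \<open>\<tau> = - 1 / 3\<close> and \<open>w \<bullet> x = 5 / 6\<close>, which is not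
      \<open>c\<close> up to sign.\<close>
    have "w \<bullet> y' \<noteq> - c"
    proof
      assume a: "w \<bullet> y' = - c"
      note o = obtuse_triangle[OF p(1) y'(2) w(1) p(3) w(2) a c(1)]
      have "w \<bullet> x = c - \<tau>" using p by (simp add: o(2) inner_simps yx)
      moreover have "\<tau> = - 1/3" unfolding \<tau>_def o(1) by (simp add: power2_eq_square)
      ultimately show False using w(3) o(1) by simp
    qed
    moreover have "w \<bullet> x \<noteq> - c"
    proof
      assume a: "w \<bullet> x = - c"
      note o = obtuse_triangle[OF p(1) u(1) w(1) p(2) w(2) a c(1)]
      have "w \<bullet> y' = c - \<tau>" using p by (simp add: o(2) inner_simps y')
      moreover have "\<tau> = - 1/3" unfolding \<tau>_def o(1) by (simp add: power2_eq_square)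
      ultimately show False using w(4) o(1) by simp
    qed
    ultimately have "w \<bullet> x = c" "w \<bullet> y' = c" using w by (auto simp: abs_if split: if_splits)
    then show ?thesis using k w by (simp add: wz algebra_simps)
  qed
  show thesis
  proof (rule that)
    show "p \<bullet> p = 1" "z \<bullet> z = 1" "\<bar>p \<bullet> x\<bar> = c" "\<bar>p \<bullet> y\<bar> = c" "\<bar>z \<bullet> p\<bar> = c" "\<bar>z \<bullet> x\<bar> = c" "\<bar>z \<bullet> y\<bar> = c"
      using p zz zp c y'(3)[of p] y'(3)[of z] by simp_all
    show "\<bar>w \<bullet> z\<bar> = 1" if w: "w \<bullet> w = 1" "\<bar>w \<bullet> p\<bar> = c" "\<bar>w \<bullet> x\<bar> = c" "\<bar>w \<bullet> y\<bar> = c" for w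
      using pos[of w] pos[of "-w"] w y'(3)[of w] by (auto simp: abs_if split: if_splits)
  qed
qed

section \<open>Isosceles triangles and the midpoints of their sides\<close>

text \<open>The squared distance of \<open>a\<close> from the reflection of \<open>p\<close> in the
  line of \<open>x\<close> is \<open>2 + 2 * (p \<bullet> a) - 4 * c^2\<close>. It vanishes for one
  sign of \<open>p \<bullet> a\<close> and would be negative for the other.\<close>

lemma double_step:
  fixes p x a :: "'a::real_inner"
  assumes "p \<bullet> p = 1" "x \<bullet> x = 1" "a \<bullet> a = 1" "p \<bullet> x = c" "x \<bullet> a = c" "\<bar>p \<bullet> a\<bar> = 2 * c^2 - 1" "1 < 2 * c^2"
  shows "a = (2 * c) *\<^sub>R x - p"
proof -
  have sw: "x \<bullet> p = c" "a \<bullet> x = c" "a \<bullet> p = p \<bullet> a" using assms by (simp_all add: inner_commute)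
  have e: "(a - ((2 * c) *\<^sub>R x - p)) \<bullet> (a - ((2 * c) *\<^sub>R x - p)) = 2 + 2 * (p \<bullet> a) - 4 * c^2"
    using assms sw by (simp add: inner_simps power2_eq_square algebra_simps)
  have "p \<bullet> a = 2 * c^2 - 1"
  proof (rule ccontr)
    assume "p \<bullet> a \<noteq> 2 * c^2 - 1"
    then have "p \<bullet> a = 1 - 2 * c^2" using assms(6) by (auto simp: abs_if split: if_splits)
    then have "2 + 2 * (p \<bullet> a) - 4 * c^2 < 0" using assms(7) by simp
    then show False using e by (metis inner_ge_zero not_less)
  qed
  then have "a - ((2 * c) *\<^sub>R x - p) = 0" using e by simp
  then show ?thesis by simp
qed

text \<open>On the geodesics from \<open>p\<close> through \<open>x\<close> and \<open>y\<close>, the points \<open>a\<close> and \<open>b\<close> lie twice as far from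
  \<open>p\<close>. The distance of \<open>a\<close> and \<open>b\<close> is the given one, and that of \<open>x\<close> and \<open>y\<close> is about half of it.\<close>

definition double_triangle :: "real \<Rightarrow> 'a::real_inner \<Rightarrow> 'a \<Rightarrow> bool" where
  "double_triangle c x y \<longleftrightarrow> (\<exists>p. p \<bullet> p = 1 \<and> (\<exists>a. a \<bullet> a = 1 \<and> (\<exists>b. b \<bullet> b = 1 \<and>
     \<bar>p \<bullet> x\<bar> = c \<and> \<bar>p \<bullet> y\<bar> = c \<and> \<bar>x \<bullet> a\<bar> = c \<and> \<bar>y \<bullet> b\<bar> = c \<and>
     \<bar>p \<bullet> a\<bar> = 2 * c^2 - 1 \<and> \<bar>p \<bullet> b\<bar> = 2 * c^2 - 1 \<and> \<bar>a \<bullet> b\<bar> = c)))"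

text \<open>By \<open>double_step\<close> the points \<open>a\<close> and \<open>b\<close> are the
  reflections of \<open>p\<close> in \<open>x\<close> and \<open>y\<close>, so
  \<open>a \<bullet> b\<close> is an affine function of \<open>x \<bullet> y\<close>, and setting it
  to \<open>c\<close> gives the value.\<close>

lemma double_triangle_dist:
  fixes x y :: "'a::real_inner"
  assumes u: "x \<bullet> x = 1" "y \<bullet> y = 1" and c: "0 < c" "c < 1" "1 < 2 * c^2" "8 * c^2 * (1 - c) < 1"
    and "double_triangle c x y"
  shows "\<bar>x \<bullet> y\<bar> = 1 - (1 - c) / (4 * c^2)"
proof -
  obtain p a b where p: "p \<bullet> p = 1" and a: "a \<bullet> a = 1" and b: "b \<bullet> b = 1"
    and n: "\<bar>p \<bullet> x\<bar> = c" "\<bar>p \<bullet> y\<bar> = c" "\<bar>x \<bullet> a\<bar> = c" "\<bar>y \<bullet> b\<bar> = c"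
    "\<bar>p \<bullet> a\<bar> = 2 * c^2 - 1" "\<bar>p \<bullet> b\<bar> = 2 * c^2 - 1" "\<bar>a \<bullet> b\<bar> = c"
    using assms unfolding double_triangle_def by blast
  obtain x' where x': "p \<bullet> x' = c" "x' \<bullet> x' = 1" "\<And>w. \<bar>w \<bullet> x'\<bar> = \<bar>w \<bullet> x\<bar>" "\<And>w. \<bar>x' \<bullet> w\<bar> = \<bar>x \<bullet> w\<bar>"
    using flip_sign[OF n(1)] u by metis
  obtain y' where y': "p \<bullet> y' = c" "y' \<bullet> y' = 1" "\<And>w. \<bar>w \<bullet> y'\<bar> = \<bar>w \<bullet> y\<bar>" "\<And>w. \<bar>y' \<bullet> w\<bar> = \<bar>y \<bullet> w\<bar>"
    using flip_sign[OF n(2)] u by metis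
  obtain a' where a': "x' \<bullet> a' = c" "a' \<bullet> a' = 1" "\<And>w. \<bar>w \<bullet> a'\<bar> = \<bar>w \<bullet> a\<bar>" "\<And>w. \<bar>a' \<bullet> w\<bar> = \<bar>a \<bullet> w\<bar>"
    using flip_sign[of x' a c] n(3) x'(4) a by metis
  obtain b' where b': "y' \<bullet> b' = c" "b' \<bullet> b' = 1" "\<And>w. \<bar>w \<bullet> b'\<bar> = \<bar>w \<bullet> b\<bar>"
    using flip_sign[of y' b c] n(4) y'(4) b by metis
  define \<tau> where "\<tau> = x' \<bullet> y'"
  have sw: "x' \<bullet> p = c" "y' \<bullet> p = c" using x' y' by (simp_all add: inner_commute)
  have ea: "a' = (2 * c) *\<^sub>R x' - p"
    by (rule double_step) (use p x' a' n(5) c in simp_all)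
  have eb: "b' = (2 * c) *\<^sub>R y' - p"
    by (rule double_step) (use p y' b' n(6) c in simp_all)
  have "a' \<bullet> b' = 4 * c^2 * \<tau> - 4 * c^2 + 1"
    by (simp add: ea eb inner_simps sw x' y' p \<tau>_def[symmetric] power2_eq_square algebra_simps)
  moreover have "\<bar>a' \<bullet> b'\<bar> = c" using n(7) a'(4) b'(3) by metis
  \<comment> \<open>For the other sign, Cauchy-Schwarz for \<open>p\<close> and
    \<open>x' + y'\<close> would give \<open>1 \<le> 8 * c^2 * (1 - c)\<close>.\<close>
  moreover have "4 * c^2 * \<tau> - 4 * c^2 + 1 \<noteq> - c"
  proof
    assume e: "4 * c^2 * \<tau> - 4 * c^2 + 1 = - c"
    have "(p \<bullet> (x' + y'))^2 \<le> (p \<bullet> p) * ((x' + y') \<bullet> (x' + y'))" by (rule Cauchy_Schwarz_ineq)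
    then have "4 * c^2 \<le> 2 + 2 * \<tau>"
      using x' y' p by (simp add: inner_simps \<tau>_def power2_eq_square inner_commute)
    then have "2 * c^2 * (4 * c^2) \<le> 2 * c^2 * (2 + 2 * \<tau>)" using c by (intro mult_left_mono) auto
    then have "8 * c^2 * c^2 \<le> 8 * c^2 - 1 - c" using e by (simp add: algebra_simps)
    then have "(1 + c) * 1 \<le> (1 + c) * (8 * c^2 * (1 - c))" by (simp add: algebra_simps power2_eq_square)
    then show False using c by simp
  qed
  ultimately have "4 * c^2 * \<tau> - 4 * c^2 + 1 = c" by (auto simp: abs_if split: if_splits)
  then have "\<tau> = 1 - (1 - c) / (4 * c^2)" using c by (simp add: field_simps)
  moreover have "(1 - c) / (4 * c^2) < 1" using c by (simp add: field_simps)
  ultimately have "\<bar>x' \<bullet> y'\<bar> = 1 - (1 - c) / (4 * c^2)" by (simp add: \<tau>_def)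
  then show ?thesis using x'(4) y'(3) by metis
qed

lemma double_triangle_ex:
  fixes x y :: "'a::real_inner"
  assumes D: "\<And>a b::'a. \<exists>e. e \<bullet> e = 1 \<and> e \<bullet> a = 0 \<and> e \<bullet> b = 0"
    and u: "x \<bullet> x = 1" "y \<bullet> y = 1" and c: "0 < c" "c < 1" "1 < 2 * c^2"
    and t: "\<bar>x \<bullet> y\<bar> = 1 - (1 - c) / (4 * c^2)"
  shows "double_triangle c x y"
proof -
  define \<tau> where "\<tau> = 1 - (1 - c) / (4 * c^2)"
  obtain y' where y': "x \<bullet> y' = \<tau>" "y' \<bullet> y' = 1" "\<And>w. \<bar>w \<bullet> y'\<bar> = \<bar>w \<bullet> y\<bar>" "\<And>w. \<bar>y' \<bullet> w\<bar> = \<bar>y \<bullet> w\<bar>"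
    using flip_sign[OF t] u unfolding \<tau>_def by metis
  have yx: "y' \<bullet> x = \<tau>" using y' by (simp add: inner_commute)
  have \<tau>: "4 * c^2 * \<tau> = 4 * c^2 - 1 + c" using c by (simp add: \<tau>_def field_simps)
  have "2 * c^2 \<le> 1 + x \<bullet> y'"
  proof -
    \<comment> \<open>The condition for a common neighbour, multiplied by \<open>4 * c^2\<close>,
      reads \<open>1 - c \<le> 8 * c^2 * (1 - c) * (1 + c)\<close>.\<close>
    have "(1 - c) * 1 \<le> (1 - c) * ((4 * (2 * c^2)) * (1 + c))"
    proof (intro mult_left_mono)
      have "1 * 1 \<le> (4 * (2 * c^2)) * (1 + c)" using c by (intro mult_mono) auto
      then show "1 \<le> (4 * (2 * c^2)) * (1 + c)" by simp
    qed (use c in auto)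
    then have "4 * c^2 * (2 * c^2) \<le> 4 * c^2 + 4 * c^2 * \<tau>"
      unfolding \<tau> by (simp add: algebra_simps power2_eq_square)
    then have "4 * c^2 * (2 * c^2) \<le> 4 * c^2 * (1 + \<tau>)" by (simp add: algebra_simps)
    then have "2 * c^2 \<le> 1 + \<tau>" by (rule mult_left_le_imp_le) (use c in simp)
    then show ?thesis using y' by simp
  qed
  then obtain p where p: "p \<bullet> p = 1" "p \<bullet> x = c" "p \<bullet> y' = c"
    using common_neighbour[OF D u(1) y'(2), of c] c by auto
  have xp: "x \<bullet> p = c" "y' \<bullet> p = c" using p by (simp_all add: inner_commute)
  define a where "a = (2 * c) *\<^sub>R x - p"
  define b where "b = (2 * c) *\<^sub>R y' - p"
  have "a \<bullet> a = 1" "b \<bullet> b = 1" "x \<bullet> a = c" "y' \<bullet> b = c" "p \<bullet> a = 2 * c^2 - 1" "p \<bullet> b = 2 * c^2 - 1"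
    by (simp_all add: a_def b_def inner_simps p xp u y' yx power2_eq_square algebra_simps)
  moreover have "a \<bullet> b = c"
    using \<tau> by (simp add: a_def b_def inner_simps p xp u y' yx power2_eq_square algebra_simps)
  ultimately show ?thesis
    unfolding double_triangle_def using p c y'(3)[of p] y'(4)[of b]
    by (intro exI[of _ p] exI[of _ a] exI[of _ b] conjI) simp_all
qed

subsection \<open>Preserved angles\<close>

text \<open>Lines are represented by unit vectors up to sign; \<open>\<bar>x \<bullet> y\<bar> = 1\<close> says that \<open>x\<close> and \<open>y\<close> span the
  same line. The condition \<open>orth\<close> says that the dimension is at least 3.\<close>

locale sphere_map =
  fixes f :: "'a::real_inner \<Rightarrow> 'a"
  assumes unit: "x \<bullet> x = 1 \<Longrightarrow> f x \<bullet> f x = 1"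
    and same: "x \<bullet> x = 1 \<Longrightarrow> y \<bullet> y = 1 \<Longrightarrow> \<bar>f x \<bullet> f y\<bar> = 1 \<longleftrightarrow> \<bar>x \<bullet> y\<bar> = 1"
    and surj: "y \<bullet> y = 1 \<Longrightarrow> \<exists>x. x \<bullet> x = 1 \<and> \<bar>f x \<bullet> y\<bar> = 1"
    and orth: "\<exists>e::'a. e \<bullet> e = 1 \<and> e \<bullet> a = 0 \<and> e \<bullet> b = 0"
begin

section \<open>Transport of quantified statements along the map\<close>

definition pres :: "real \<Rightarrow> bool" where
  "pres t \<longleftrightarrow> (\<forall>x y. x \<bullet> x = 1 \<longrightarrow> y \<bullet> y = 1 \<longrightarrow> (\<bar>f x \<bullet> f y\<bar> = t \<longleftrightarrow> \<bar>x \<bullet> y\<bar> = t))"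

lemma presD: "pres t \<Longrightarrow> x \<bullet> x = 1 \<Longrightarrow> y \<bullet> y = 1 \<Longrightarrow> \<bar>f x \<bullet> f y\<bar> = t \<longleftrightarrow> \<bar>x \<bullet> y\<bar> = t"
  by (auto simp: pres_def)

lemma presI:
  assumes "\<And>x y. x \<bullet> x = 1 \<Longrightarrow> y \<bullet> y = 1 \<Longrightarrow> \<bar>x \<bullet> y\<bar> = t \<longleftrightarrow> R x y"
    and "\<And>x y. x \<bullet> x = 1 \<Longrightarrow> y \<bullet> y = 1 \<Longrightarrow> R (f x) (f y) \<longleftrightarrow> R x y"
  shows "pres t"
  using assms unit by (auto simp: pres_def)

text \<open>Since \<open>f\<close> is onto only up to sign, a witness is \<open>f x\<close> or
  \<open>- f x\<close>; invariance of \<open>Q\<close> under sign covers the second case.\<close>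

lemma ex_f:
  assumes "\<And>z. Q (- z) = Q z" "\<And>z. z \<bullet> z = 1 \<Longrightarrow> Q (f z) \<longleftrightarrow> P z"
  shows "(\<exists>z. z \<bullet> z = 1 \<and> Q z) \<longleftrightarrow> (\<exists>z. z \<bullet> z = 1 \<and> P z)"
proof
  assume "\<exists>z. z \<bullet> z = 1 \<and> Q z"
  then obtain z where z: "z \<bullet> z = 1" "Q z" by blast
  then obtain x where x: "x \<bullet> x = 1" "\<bar>f x \<bullet> z\<bar> = 1" using surj by blast
  then have "z = f x \<or> z = - f x" using unit_abs_inner_eq_1 unit z by metis
  then show "\<exists>z. z \<bullet> z = 1 \<and> P z" using assms z x by metis
qed (use assms unit in blast)

lemma all_f:
  assumes "\<And>z. Q (- z) = Q z" "\<And>z. z \<bullet> z = 1 \<Longrightarrow> Q (f z) \<longleftrightarrow> P z"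
  shows "(\<forall>z. z \<bullet> z = 1 \<longrightarrow> Q z) \<longleftrightarrow> (\<forall>z. z \<bullet> z = 1 \<longrightarrow> P z)"
  using ex_f[of "\<lambda>z. \<not> Q z" "\<lambda>z. \<not> P z"] assms by auto

lemma one_line_f:
  assumes Q: "\<And>z. Q (- z) = Q z" "\<And>z. z \<bullet> z = 1 \<Longrightarrow> Q (f z) \<longleftrightarrow> P z"
  shows "one_line Q \<longleftrightarrow> one_line P"
  unfolding one_line_def
proof (rule ex_f, goal_cases)
  case (2 z)
  then show ?case
    using all_f[of "\<lambda>q. Q q \<longrightarrow> \<bar>q \<bullet> f z\<bar> = 1" "\<lambda>q. P q \<longrightarrow> \<bar>q \<bullet> z\<bar> = 1"] Q same by (simp add: imp_conjL)
qed (simp add: Q)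

lemma three_lines_f:
  assumes Q: "\<And>z. Q (- z) = Q z" "\<And>z. z \<bullet> z = 1 \<Longrightarrow> Q (f z) \<longleftrightarrow> P z"
  shows "three_lines Q \<longleftrightarrow> three_lines P"
proof -
  \<comment> \<open>A form with one quantifier at a time, so that \<open>ex_f\<close> can be applied
    three times.\<close>
  define T where "T P p q r \<longleftrightarrow> P p \<and> P q \<and> P r \<and>
     \<bar>p \<bullet> q\<bar> \<noteq> 1 \<and> \<bar>p \<bullet> r\<bar> \<noteq> 1 \<and> \<bar>q \<bullet> r\<bar> \<noteq> 1 \<and>
     (\<forall>s. s \<bullet> s = 1 \<longrightarrow> P s \<longrightarrow> \<bar>s \<bullet> p\<bar> = 1 \<or> \<bar>s \<bullet> q\<bar> = 1 \<or> \<bar>s \<bullet> r\<bar> = 1)" for P and p q r :: 'a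
  have three: "three_lines P = (\<exists>p. p \<bullet> p = 1 \<and> (\<exists>q. q \<bullet> q = 1 \<and> (\<exists>r. r \<bullet> r = 1 \<and> T P p q r)))" for P
    unfolding three_lines_def T_def by blast
  have m: "T Q (- p) q r = T Q p q r" "T Q p (- q) r = T Q p q r" "T Q p q (- r) = T Q p q r" for p q r
    unfolding T_def by (simp_all add: Q)
  have T: "T Q (f p) (f q) (f r) = T P p q r" if "p \<bullet> p = 1" "q \<bullet> q = 1" "r \<bullet> r = 1" for p q r
    unfolding T_def
    using all_f[of "\<lambda>s. Q s \<longrightarrow> \<bar>s \<bullet> f p\<bar> = 1 \<or> \<bar>s \<bullet> f q\<bar> = 1 \<or> \<bar>s \<bullet> f r\<bar> = 1"
         "\<lambda>s. P s \<longrightarrow> \<bar>s \<bullet> p\<bar> = 1 \<or> \<bar>s \<bullet> q\<bar> = 1 \<or> \<bar>s \<bullet> r\<bar> = 1"] that Q same by simp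
  show ?thesis unfolding three
    by (rule ex_f, simp add: m, rule ex_f, simp add: m, rule ex_f, simp_all add: m T)
qed

section \<open>New preserved values from old ones\<close>

lemma pres_double:
  assumes c: "pres c" "0 < c" "1 < 2 * c^2"
  shows "pres (2 * c^2 - 1)"
proof (rule presI)
  fix x y :: 'a assume u: "x \<bullet> x = 1" "y \<bullet> y = 1"
  show "\<bar>x \<bullet> y\<bar> = 2 * c^2 - 1 \<longleftrightarrow> one_line (\<lambda>z. \<bar>z \<bullet> x\<bar> = c \<and> \<bar>z \<bullet> y\<bar> = c)"
  proof
    assume t: "\<bar>x \<bullet> y\<bar> = 2 * c^2 - 1"
    show "one_line (\<lambda>z. \<bar>z \<bullet> x\<bar> = c \<and> \<bar>z \<bullet> y\<bar> = c)"
      by (rule unique_neighbour_ex[OF u c(2,3) t]) (auto simp: one_line_def)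
  next
    assume "one_line (\<lambda>z. \<bar>z \<bullet> x\<bar> = c \<and> \<bar>z \<bullet> y\<bar> = c)"
    then have "\<bar>x \<bullet> y\<bar> = \<bar>2 * c^2 - 1\<bar>"
      unfolding one_line_def using unique_neighbour_dist[OF u _ _ _ c(2)] by blast
    then show "\<bar>x \<bullet> y\<bar> = 2 * c^2 - 1" using c by simp
  qed
  show "one_line (\<lambda>z. \<bar>z \<bullet> f x\<bar> = c \<and> \<bar>z \<bullet> f y\<bar> = c) \<longleftrightarrow> one_line (\<lambda>z. \<bar>z \<bullet> x\<bar> = c \<and> \<bar>z \<bullet> y\<bar> = c)"
    by (rule one_line_f) (use presD[OF c(1)] u in auto)
qed

lemma isolated_f:
  assumes c: "pres c" and u: "x \<bullet> x = 1" "y \<bullet> y = 1" "p \<bullet> p = 1"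
  shows "isolated c (f x) (f y) (f p) \<longleftrightarrow> isolated c x y p"
proof -
  have "(\<forall>q. q \<bullet> q = 1 \<longrightarrow> \<bar>q \<bullet> f x\<bar> = c \<and> \<bar>q \<bullet> f y\<bar> = c \<longrightarrow> \<bar>q \<bullet> f p\<bar> \<noteq> c) \<longleftrightarrow>
    (\<forall>q. q \<bullet> q = 1 \<longrightarrow> \<bar>q \<bullet> x\<bar> = c \<and> \<bar>q \<bullet> y\<bar> = c \<longrightarrow> \<bar>q \<bullet> p\<bar> \<noteq> c)"
    by (rule all_f) (use presD[OF c] u in auto)
  then show ?thesis unfolding isolated_def using presD[OF c] u unit by auto
qed

lemma pres_isolated:
  assumes c: "pres c" "0 < c" "2 * c^2 < 1" "2 * c^2 \<le> (1 + c) * (1 - c^2)"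
  shows "pres (1 - 2 * c^2)"
proof (rule presI)
  fix x y :: 'a assume u: "x \<bullet> x = 1" "y \<bullet> y = 1"
  show "\<bar>x \<bullet> y\<bar> = 1 - 2 * c^2 \<longleftrightarrow> one_line (isolated c x y) \<or> three_lines (isolated c x y)"
    using isolated_odd_dist[OF u c(2)] isolated_odd_ex[OF orth u c(2-4)] c by auto
  show "one_line (isolated c (f x) (f y)) \<or> three_lines (isolated c (f x) (f y)) \<longleftrightarrow>
     one_line (isolated c x y) \<or> three_lines (isolated c x y)"
    using one_line_f[of "isolated c (f x) (f y)" "isolated c x y"]
      three_lines_f[of "isolated c (f x) (f y)" "isolated c x y"] isolated_f[OF c(1) u] isolated_uminus(2) by blast
qed

lemma pres_rhombus:
  assumes c: "pres c" "1 / 2 \<le> c" "c < 1"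
  shows "pres \<bar>4 * c^2 / (1 + c) - 1\<bar>"
proof (rule presI)
  fix x y :: 'a assume u: "x \<bullet> x = 1" "y \<bullet> y = 1"
  let ?R = "\<lambda>x y p. \<bar>p \<bullet> x\<bar> = c \<and> \<bar>p \<bullet> y\<bar> = c \<and>
    one_line (\<lambda>z. \<bar>z \<bullet> p\<bar> = c \<and> \<bar>z \<bullet> x\<bar> = c \<and> \<bar>z \<bullet> y\<bar> = c)"
  show "\<bar>x \<bullet> y\<bar> = \<bar>4 * c^2 / (1 + c) - 1\<bar> \<longleftrightarrow> (\<exists>p. p \<bullet> p = 1 \<and> ?R x y p)"
  proof
    assume t: "\<bar>x \<bullet> y\<bar> = \<bar>4 * c^2 / (1 + c) - 1\<bar>"
    show "\<exists>p. p \<bullet> p = 1 \<and> ?R x y p"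
      by (rule rhombus_ex[OF orth u c(2,3) t]) (unfold one_line_def, blast)
  next
    assume "\<exists>p. p \<bullet> p = 1 \<and> ?R x y p"
    then show "\<bar>x \<bullet> y\<bar> = \<bar>4 * c^2 / (1 + c) - 1\<bar>"
      unfolding one_line_def using rhombus_dist[OF orth u _ _ c(2,3)] by blast
  qed
  have one: "one_line (\<lambda>z. \<bar>z \<bullet> f p\<bar> = c \<and> \<bar>z \<bullet> f x\<bar> = c \<and> \<bar>z \<bullet> f y\<bar> = c) \<longleftrightarrow>
     one_line (\<lambda>z. \<bar>z \<bullet> p\<bar> = c \<and> \<bar>z \<bullet> x\<bar> = c \<and> \<bar>z \<bullet> y\<bar> = c)" if "p \<bullet> p = 1" for p
    by (rule one_line_f) (use presD[OF c(1)] u that in auto)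
  show "(\<exists>p. p \<bullet> p = 1 \<and> ?R (f x) (f y) p) \<longleftrightarrow> (\<exists>p. p \<bullet> p = 1 \<and> ?R x y p)"
    by (rule ex_f) (use presD[OF c(1)] u one in auto)
qed

lemma pres_double_triangle:
  assumes c: "pres c" "0 < c" "c < 1" "1 < 2 * c^2" "8 * c^2 * (1 - c) < 1"
  shows "pres (1 - (1 - c) / (4 * c^2))"
proof (rule presI)
  fix x y :: 'a assume u: "x \<bullet> x = 1" "y \<bullet> y = 1"
  show "\<bar>x \<bullet> y\<bar> = 1 - (1 - c) / (4 * c^2) \<longleftrightarrow> double_triangle c x y"
    using double_triangle_dist[OF u c(2-5)] double_triangle_ex[OF orth u c(2-4)] by blast
  \<comment> \<open>The triangle involves the value \<open>2 * c^2 - 1\<close> besides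
    \<open>c\<close>, and \<open>pres_double\<close> preserves it.\<close>
  note P = presD[OF c(1)] presD[OF pres_double[OF c(1,2,4)]]
  show "double_triangle c (f x) (f y) \<longleftrightarrow> double_triangle c x y"
    unfolding double_triangle_def
    by (rule ex_f, simp, rule ex_f, simp, rule ex_f, simp, simp add: P u)
qed

end

section \<open>Numerical bounds and the triangle inequality\<close>

text \<open>Linear bounds for the square on an interval, the upper one being the chord; they reduce
  the estimates below to linear arithmetic.\<close>

lemma square_between:
  fixes c :: real
  assumes "l \<le> c" "c \<le> u" "0 \<le> l"
  shows "l * c \<le> c^2" "c^2 \<le> (l + u) * c - l * u"
proof -
  show "l * c \<le> c^2" using assms by (simp add: power2_eq_square mult_right_mono)
  have "0 \<le> (c - l) * (u - c)" using assms by simp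
  then show "c^2 \<le> (l + u) * c - l * u" by (simp add: algebra_simps power2_eq_square)
qed

text \<open>This is the triangle inequality for angles between lines. After the components along
  \<open>y\<close> are removed, Cauchy-Schwarz bounds the inner product of the remainders by
  \<open>sin a * sin b\<close>.\<close>

lemma abs_inner_triangle:
  fixes x y z :: "'a::real_inner"
  assumes u: "x \<bullet> x = 1" "y \<bullet> y = 1" "z \<bullet> z = 1"
    and ab: "0 \<le> a" "0 \<le> b" "a + b \<le> pi / 2"
    and xy: "cos a \<le> \<bar>x \<bullet> y\<bar>" and yz: "cos b \<le> \<bar>y \<bullet> z\<bar>"
  shows "cos (a + b) \<le> \<bar>x \<bullet> z\<bar>"
proof -
  obtain x' where x': "y \<bullet> x' = \<bar>x \<bullet> y\<bar>" "x' \<bullet> x' = 1" "\<And>w. \<bar>x' \<bullet> w\<bar> = \<bar>x \<bullet> w\<bar>"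
    using flip_sign[of y x "\<bar>x \<bullet> y\<bar>"] u by (metis inner_commute)
  obtain z' where z': "y \<bullet> z' = \<bar>y \<bullet> z\<bar>" "z' \<bullet> z' = 1" "\<And>w. \<bar>w \<bullet> z'\<bar> = \<bar>w \<bullet> z\<bar>"
    using flip_sign[of y z "\<bar>y \<bullet> z\<bar>"] u by metis
  define p q where "p = \<bar>x \<bullet> y\<bar>" and "q = \<bar>y \<bullet> z\<bar>"
  have pq: "p \<le> 1" "q \<le> 1" using unit_inner_le_1 u by (auto simp: p_def q_def)
  have ca: "0 \<le> cos a" "0 \<le> cos b" "0 \<le> sin a" "0 \<le> sin b"
    using ab by (auto intro!: cos_ge_zero sin_ge_zero)
  then have pq0: "0 \<le> p" "0 \<le> q" by (simp_all add: p_def q_def)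
  have sw: "x' \<bullet> y = p" "z' \<bullet> y = q" "y \<bullet> x' = p" "y \<bullet> z' = q" using x' z' by (simp_all add: inner_commute p_def q_def)
  define v w where "v = x' - p *\<^sub>R y" and "w = z' - q *\<^sub>R y"
  have vw: "v \<bullet> v = 1 - p^2" "w \<bullet> w = 1 - q^2" "v \<bullet> w = x' \<bullet> z' - p * q"
    by (simp_all add: v_def w_def inner_simps sw x' z' u power2_eq_square)
  have "1 - p^2 \<le> (sin a)^2" "1 - q^2 \<le> (sin b)^2"
    using power_mono[OF xy ca(1), of 2] power_mono[OF yz ca(2), of 2] by (simp_all add: sin_squared_eq p_def q_def)
  then have nv: "norm v \<le> sin a" "norm w \<le> sin b"
    using vw ca by (auto intro!: power2_le_imp_le[of "norm _"] simp: power2_norm_eq_inner)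
  have "\<bar>v \<bullet> w\<bar> \<le> norm v * norm w" by (rule Cauchy_Schwarz_ineq2)
  also have "\<dots> \<le> sin a * sin b" using nv ca by (intro mult_mono) auto
  finally have "p * q - sin a * sin b \<le> x' \<bullet> z'" using vw by simp
  moreover have "cos a * cos b \<le> p * q" using xy yz ca pq0 by (intro mult_mono) (auto simp: p_def q_def)
  ultimately have "cos (a + b) \<le> x' \<bullet> z'" by (simp add: cos_add)
  also have "\<dots> \<le> \<bar>x' \<bullet> z'\<bar>" by simp
  also have "\<dots> = \<bar>x \<bullet> z\<bar>" using x' z' by metis
  finally show ?thesis .
qed

context sphere_map
begin

text \<open>The bound makes \<open>8 * t^2 * (1 - t) < 1\<close>, as \<open>pres_double_triangle\<close> requires; the threshold of
  that condition is \<open>t = cos (pi / 5)\<close>, approximately 0.809.\<close>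

definition pres_large :: bool where
  "pres_large \<longleftrightarrow> (\<exists>t. pres t \<and> 81 / 100 < t \<and> t < 1)"

section \<open>From any preserved value to one above 81/100\<close>

text \<open>A round bound below the positive root, about 0.675, of
  \<open>2 * c^2 = (1 + c) * (1 - c^2)\<close>.\<close>

lemma pres_isolated':
  assumes "pres c" "0 < c" "c \<le> 13 / 20"
  shows "pres (1 - 2 * c^2)"
proof (rule pres_isolated)
  have c2: "c^2 \<le> 13/20 * c" using square_between(2)[of 0 c "13/20"] assms by simp
  then show "2 * c^2 < 1" using assms by simp
  have "c * c^2 \<le> 13/20 * c^2" using assms by (intro mult_right_mono) auto
  then have "2 * c^2 + c^2 + c * c^2 \<le> 1 + c" using c2 assms by linarith
  then show "2 * c^2 \<le> (1 + c) * (1 - c^2)" by (simp add: algebra_simps)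
qed (use assms in auto)

text \<open>Here \<open>1 - 2 * c^2\<close> is at least 82/100.\<close>

lemma pres_large_small:
  assumes "pres c" "0 < c" "c \<le> 3 / 10"
  shows pres_large
proof -
  have "c^2 \<le> 9/100" using square_between(2)[of 0 c "3/10"] assms by simp
  moreover have "0 < c^2" using assms by simp
  ultimately show ?thesis
    unfolding pres_large_def using pres_isolated'[OF assms(1,2)] assms(3)
    by (intro exI[of _ "1 - 2 * c^2"]) auto
qed

lemma rhombus_value:
  fixes c k :: real
  assumes "0 < c"
  shows "k \<le> 4 * c^2 / (1 + c) - 1 \<longleftrightarrow> k + k * c \<le> 4 * c^2 - 1 - c"
    "k < 4 * c^2 / (1 + c) - 1 \<longleftrightarrow> k + k * c < 4 * c^2 - 1 - c"
    "4 * c^2 / (1 + c) - 1 \<le> k \<longleftrightarrow> 4 * c^2 - 1 - c \<le> k + k * c"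
    "4 * c^2 / (1 + c) - 1 < k \<longleftrightarrow> 4 * c^2 - 1 - c < k + k * c"
  using assms by (auto simp: field_simps)

text \<open>On each of three subintervals one value falls into the range of
  \<open>pres_large_small\<close>. They are arranged to avoid the zeros of the values used: about
  0.640 for the rhombus and 0.707 for \<open>1 - 2 * c^2\<close>.\<close>

lemma pres_large_middle:
  assumes c: "pres c" "52 / 100 \<le> c" "c \<le> 72 / 100"
  shows pres_large
proof -
  define q where "q = 4 * c^2 / (1 + c) - 1"
  have "0 < c" using c by simp
  note le = rhombus_value[OF this, folded q_def]
  have G: "pres \<bar>q\<bar>" using pres_rhombus[OF c(1)] c by (simp add: q_def)
  consider "c \<le> 6/10" | "6/10 \<le> c" "c \<le> 65/100" | "65/100 \<le> c" by linarith
  then show ?thesis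
  proof cases
    case 1
    then have "- 3/10 \<le> q" "q < 0"
      using square_between[of "52/100" c "6/10"] c unfolding le by simp_all
    then show ?thesis by (intro pres_large_small[OF G]) auto
  next
    case 2
    then have "0 < 1 - 2 * c^2" "1 - 2 * c^2 \<le> 3/10"
      using square_between[of "6/10" c "65/100"] by auto
    then show ?thesis using 2 c by (intro pres_large_small[OF pres_isolated'[OF c(1)]]) auto
  next
    case 3
    then have "0 < q" "q \<le> 3/10"
      using square_between[of "65/100" c "72/100"] c unfolding le by simp_all
    then show ?thesis by (intro pres_large_small[OF G]) auto
  qed
qed

text \<open>Doubling the angle leads to a small value up to 806/1000. The gap up to 81/100 is closed
  by a rhombus step to about 0.44, from which \<open>1 - 2 * q^2\<close> lands near 0.6, in the
  middle range.\<close>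

lemma pres_large_upper:
  assumes c: "pres c" "52 / 100 \<le> c" "c < 1"
  shows pres_large
proof -
  consider "c \<le> 72/100" | "72/100 \<le> c" "c \<le> 806/1000" | "806/1000 \<le> c" "c \<le> 81/100" | "81/100 < c" by linarith
  then show ?thesis
  proof cases
    case 1
    then show ?thesis using pres_large_middle c by blast
  next
    case 2
    then have "0 < 2 * c^2 - 1" "2 * c^2 - 1 \<le> 3/10"
      using square_between[of "72/100" c "806/1000"] by auto
    then show ?thesis using 2 c by (intro pres_large_small[OF pres_double[OF c(1)]]) auto
  next
    case 3
    define q where "q = 4 * c^2 / (1 + c) - 1"
  have "0 < c" using c by simp
  note le = rhombus_value[OF this, folded q_def]
    have b: "438/1000 \<le> q" "q \<le> 451/1000"
      using square_between[of "806/1000" c "81/100"] 3 unfolding le by simp_all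
    then have "pres q" using pres_rhombus[OF c(1)] c by (simp flip: q_def)
    then have "pres (1 - 2 * q^2)" using pres_isolated' b by simp
    then show ?thesis using square_between[of "438/1000" q "451/1000"] b by (intro pres_large_middle) auto
  next
    case 4
    then show ?thesis unfolding pres_large_def using c by blast
  qed
qed

text \<open>Near \<open>1 / 2\<close> the rhombus value \<open>q\<close> lies between about -1/3 and
  -0.28, so \<open>1 - 2 * q^2\<close> lies between 0.77 and 0.85.\<close>

lemma pres_large_half:
  assumes c: "pres c" "1 / 2 \<le> c" "c < 1"
  shows pres_large
proof (cases "c \<le> 52/100")
  case False
  then show ?thesis using pres_large_upper c by simp
next
  case True
  define q where "q = 4 * c^2 / (1 + c) - 1"
  have "0 < c" using c by simp
  note le = rhombus_value[OF this, folded q_def]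
  have b: "- 3334/10000 \<le> q" "q \<le> - 28/100"
    using square_between[of "1/2" c "52/100"] True c unfolding le by simp_all
  have "pres \<bar>q\<bar>" using pres_rhombus[OF c(1)] c by (simp add: q_def)
  then have "pres (1 - 2 * q^2)" using pres_isolated'[of "\<bar>q\<bar>"] b by simp
  then show ?thesis using square_between[of "28/100" "- q" "3334/10000"] b by (intro pres_large_upper) auto
qed

lemma pres_large:
  assumes c: "pres c" "0 < c" "c < 1"
  shows pres_large
proof (cases "c < 1/2")
  case True
  have "c^2 < 1/4" using True c power_strict_mono[of c "1/2" 2] by (simp add: power2_eq_square)
  moreover have "0 < c^2" using c by simp
  ultimately show ?thesis using True c by (intro pres_large_half[OF pres_isolated'[OF c(1)]]) auto
qed (use pres_large_half c in auto)

section \<open>Arbitrarily small preserved angles\<close>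

text \<open>One triangle step divides \<open>1 - t\<close> by \<open>4 * t^2\<close>, which exceeds
  2, and so keeps the new value above 81/100.\<close>

lemma pres_close_to_1:
  assumes c: "pres c" "0 < c" "c < 1"
  shows "\<exists>t. pres t \<and> 81 / 100 < t \<and> t < 1 \<and> 1 - t \<le> (1 / 2)^n"
proof (induction n)
  case 0
  obtain t where "pres t" "81 / 100 < t" "t < 1" using pres_large[OF c] unfolding pres_large_def by blast
  then show ?case by (intro exI[of _ t]) auto
next
  case (Suc n)
  then obtain t where t: "pres t" "81 / 100 < t" "t < 1" "1 - t \<le> (1 / 2)^n" by blast
  have t2: "1 < 2 * t^2" using square_between(1)[of "81/100" t 1] t by auto
  \<comment> \<open>The tangent of the square at 81/100. With the chord on the interval up to 1 it
    bounds the cubic \<open>t^2 * (1 - t)\<close> linearly.\<close>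
  have t3: "81/100 * (2 * t - 81/100) \<le> t^2" using zero_le_power2[of "t - 81/100"] by (simp add: power2_eq_square algebra_simps)
  have "t^2 * (1 - t) \<le> (181/100 * t - 81/100) * (1 - t)"
    using square_between(2)[of "81/100" t 1] t by (intro mult_right_mono) auto
  also have "\<dots> = 262/100 * t - 81/100 - 181/100 * t^2" by (simp add: field_simps power2_eq_square)
  finally have "8 * t^2 * (1 - t) < 1" using t3 t(2) by simp
  then have p: "pres (1 - (1 - t) / (4 * t^2))" using pres_double_triangle t t2 by simp
  define d where "d = (1 - t) / (4 * t^2)"
  have "0 < d" using t by (simp add: d_def)
  have "(1 - t) / (4 * t^2) \<le> (1 - t) / 2" using t t2 by (intro divide_left_mono) auto
  then have "d \<le> (1 - t) / 2" by (simp add: d_def)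
  then show ?case using p[folded d_def] \<open>0 < d\<close> t by (intro exI[of _ "1 - d"]) auto
qed

section \<open>Chains of small steps\<close>

text \<open>Going from \<open>n\<close> to \<open>n + 1\<close> steps, a point at angle
  \<open>b\<close> from \<open>y\<close> is chosen within \<open>n * b\<close> of \<open>x\<close>.
  The images satisfy the same bounds by induction and preservation of \<open>b\<close>, and the
  triangle inequality adds them.\<close>

lemma chain:
  assumes b: "pres (cos b)" "0 < b"
    and k: "2 \<le> k" "real k * b \<le> pi / 2"
    and u: "x \<bullet> x = 1" "y \<bullet> y = 1" and xy: "cos (real k * b) \<le> \<bar>x \<bullet> y\<bar>"
  shows "cos (real k * b) \<le> \<bar>f x \<bullet> f y\<bar>"
  using k u xy
proof (induction k arbitrary: y rule: dec_induct)
  \<comment> \<open>The induction starts at 2: lines at angle at most \<open>2 * b\<close> have a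
    common neighbour at angle \<open>b\<close>, while one step reaches only the exact angle
    \<open>b\<close>.\<close>
  case base
  have cb: "cos b > 0" using base b by (intro cos_gt_zero) auto
  obtain y' where y': "x \<bullet> y' = \<bar>x \<bullet> y\<bar>" "y' \<bullet> y' = 1" "\<And>w. \<bar>w \<bullet> y'\<bar> = \<bar>w \<bullet> y\<bar>"
    using flip_sign[of x y "\<bar>x \<bullet> y\<bar>"] base by metis
  have "2 * (cos b)^2 \<le> 1 + x \<bullet> y'" using base y' by (simp add: cos_double_cos)
  then obtain z where z: "z \<bullet> z = 1" "z \<bullet> x = cos b" "z \<bullet> y' = cos b"
    using common_neighbour[OF orth base(2) y'(2) _ cb] by blast
  then have "\<bar>z \<bullet> x\<bar> = cos b" "\<bar>z \<bullet> y\<bar> = cos b" using y'(3)[of z] cb by auto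
  then have "\<bar>f x \<bullet> f z\<bar> = cos b" "\<bar>f z \<bullet> f y\<bar> = cos b"
    using presD[OF b(1)] z base by (simp_all add: inner_commute)
  then show ?case using abs_inner_triangle[of "f x" "f z" "f y" b b] unit z base b by simp
next
  case (step n)
  have nb: "real n * b \<le> pi / 2" "0 \<le> real n * b" using step b by (auto simp: algebra_simps)
  have eq: "real (Suc n) * b = real n * b + b" by (simp add: algebra_simps)
  have S: "real n * b + b \<le> pi" using step(4) pi_gt_zero unfolding eq by linarith
  show ?case
  proof (cases "cos (real n * b) \<le> \<bar>x \<bullet> y\<bar>")
    case True
    have "cos (real (Suc n) * b) \<le> cos (real n * b)"
      unfolding eq using S nb b by (intro cos_monotone_0_pi_le) auto
    also have "\<dots> \<le> \<bar>f x \<bullet> f y\<bar>" using step.IH[OF nb(1)] step.prems(2,3) True by blast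
    finally show ?thesis .
  next
    case False
    obtain y' where y': "x \<bullet> y' = \<bar>x \<bullet> y\<bar>" "y' \<bullet> y' = 1" "\<And>w. \<bar>w \<bullet> y'\<bar> = \<bar>w \<bullet> y\<bar>"
      using flip_sign[of x y "\<bar>x \<bullet> y\<bar>"] step by metis
    define d where "d = arccos \<bar>x \<bullet> y\<bar>"
    have le1: "\<bar>x \<bullet> y\<bar> \<le> 1" using unit_inner_le_1 step by blast
    have cd: "cos d = \<bar>x \<bullet> y\<bar>" unfolding d_def using le1 by (intro cos_arccos) auto
    have d0: "0 \<le> d" "d \<le> pi" unfolding d_def using le1 by (auto intro!: arccos_lbound arccos_ubound)
    have dn: "real n * b < d"
    proof (rule ccontr)
      assume "\<not> real n * b < d"
      then have "cos (real n * b) \<le> cos d" using d0 nb by (intro cos_monotone_0_pi_le) auto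
      then show False using False cd by simp
    qed
    have dS: "d \<le> real n * b + b"
    proof (rule ccontr)
      assume "\<not> d \<le> real n * b + b"
      then have "cos d < cos (real n * b + b)" using d0 nb b by (intro cos_monotone_0_pi) auto
      then show False using step cd eq by simp
    qed
    have "1 * b \<le> real n * b" using step b by (intro mult_right_mono) auto
    then have bd: "b < d" using dn by simp
    have sd: "sin d > 0" using step(4) dS dn nb eq d0 pi_gt_zero by (intro sin_gt_zero) linarith+
    \<comment> \<open>The point at angle \<open>b\<close> from \<open>y'\<close> on the geodesic
      from \<open>y'\<close> to \<open>x\<close>, by spherical interpolation.\<close>
    define z where "z = (sin (d - b) / sin d) *\<^sub>R y' + (sin b / sin d) *\<^sub>R x"
    have yx: "y' \<bullet> x = cos d" "x \<bullet> y' = cos d" using y' cd by (simp_all add: inner_commute)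
    have s2: "sin d * sin d = 1 - cos d * cos d" using sin_squared_eq[of d] by (simp add: power2_eq_square)
    have "z \<bullet> y' = (sin (d - b) + sin b * cos d) / sin d"
      by (simp add: z_def inner_simps yx y' add_divide_distrib)
    then have zy: "z \<bullet> y' = cos b" using sd by (simp add: sin_diff)
    have "z \<bullet> x = (sin (d - b) * cos d + sin b) / sin d"
      by (simp add: z_def inner_simps yx step add_divide_distrib)
    also have "sin (d - b) * cos d + sin b = sin d * (cos d * cos b) + sin b * (sin d * sin d)"
      unfolding s2 by (simp add: sin_diff algebra_simps)
    also have "\<dots> = cos (d - b) * sin d" by (simp add: cos_diff algebra_simps)
    finally have zx: "z \<bullet> x = cos (d - b)" using sd by simp
    have "z \<bullet> z = (sin (d - b) * (z \<bullet> y') + sin b * (z \<bullet> x)) / sin d"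
      by (subst (2) z_def) (simp add: inner_simps add_divide_distrib)
    also have "\<dots> = sin ((d - b) + b) / sin d" unfolding zx zy sin_add by (simp add: algebra_simps)
    finally have zz: "z \<bullet> z = 1" using sd by simp
    have "b < pi / 2" using \<open>1 * b \<le> real n * b\<close> b(2) step(4) unfolding eq by linarith
    then have cb: "cos b > 0" using b(2) by (intro cos_gt_zero)
    have "cos (real n * b) \<le> cos (d - b)" using bd dS nb by (intro cos_monotone_0_pi_le) auto
    also have "\<dots> \<le> \<bar>x \<bullet> z\<bar>" using zx by (simp add: inner_commute)
    finally have 1: "cos (real n * b) \<le> \<bar>f x \<bullet> f z\<bar>" using step.IH[OF nb(1)] zz step by blast
    have "\<bar>z \<bullet> y\<bar> = cos b" using zy y'(3)[of z] cb by simp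
    then have "\<bar>f z \<bullet> f y\<bar> = cos b" using presD[OF b(1)] zz step by simp
    then show ?thesis unfolding eq
      by (intro abs_inner_triangle[of "f x" "f z"])
        (use 1 unit zz step.prems(2,3) b(2) nb step(4)[unfolded eq] in simp_all)
  qed
qed

text \<open>If the angle grew from \<open>d\<close> to \<open>d'\<close>, a chain of small preserved
  steps with total length between \<open>d\<close> and \<open>d'\<close> would contradict
  \<open>chain\<close>.\<close>

lemma abs_inner_mono:
  assumes c: "pres c" "0 < c" "c < 1" and u: "x \<bullet> x = 1" "y \<bullet> y = 1"
  shows "\<bar>x \<bullet> y\<bar> \<le> \<bar>f x \<bullet> f y\<bar>"
proof (rule ccontr)
  assume less: "\<not> \<bar>x \<bullet> y\<bar> \<le> \<bar>f x \<bullet> f y\<bar>"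
  define d where "d = arccos \<bar>x \<bullet> y\<bar>"
  define d' where "d' = arccos \<bar>f x \<bullet> f y\<bar>"
  have le1: "\<bar>x \<bullet> y\<bar> \<le> 1" "\<bar>f x \<bullet> f y\<bar> \<le> 1" using unit_inner_le_1 u unit by blast+
  have cd: "cos d = \<bar>x \<bullet> y\<bar>" "cos d' = \<bar>f x \<bullet> f y\<bar>"
    unfolding d_def d'_def using le1 by (auto intro!: cos_arccos)
  have d: "0 \<le> d" "d < d'" "d' \<le> pi / 2"
    unfolding d_def d'_def using le1 less
    by (intro arccos_lbound arccos_less_arccos arccos_le_pi2; simp)+
  define s where "s = cos (min ((d' - d) / 3) (pi / 4))"
  have "s < 1" unfolding s_def using d cos_monotone_0_pi[of 0 "min ((d' - d) / 3) (pi / 4)"] by (auto simp: min_def split: if_splits)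
  then obtain n where n: "(1 / 2)^n < 1 - s" using real_arch_pow_inv[of "1 - s" "1/2"] by auto
  obtain t where t: "pres t" "81/100 < t" "t < 1" "1 - t \<le> (1/2)^n" using pres_close_to_1[OF c] by blast
  define b where "b = arccos t"
  have cb: "cos b = t" unfolding b_def using t by (intro cos_arccos) auto
  have b0: "0 < b" unfolding b_def using t arccos_less_arccos[of t 1] by simp
  have "arccos t < arccos s" using n t by (intro arccos_less_arccos) (auto simp: s_def)
  also have "arccos s = min ((d' - d) / 3) (pi / 4)" unfolding s_def using d by (intro arccos_cos) auto
  finally have b: "b < (d' - d) / 3" "b < pi / 4" by (auto simp: b_def)
  \<comment> \<open>The summand 2 provides the \<open>2 \<le> k\<close> that \<open>chain\<close>
    asks for. With the rounding, \<open>k * b\<close> exceeds \<open>d\<close> by at most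
    \<open>3 * b\<close>, whence the third of the gap in \<open>s\<close>.\<close>
  define k where "k = nat \<lceil>d / b\<rceil> + 2"
  have k: "d / b \<le> real k" "real k \<le> d / b + 3" using d b0 unfolding k_def by (auto simp: real_nat_ceiling_ge) linarith+
  then have kb: "d \<le> real k * b" "real k * b \<le> d + 3 * b" using b0 by (simp_all add: field_simps)
  have "cos (real k * b) \<le> \<bar>f x \<bullet> f y\<bar>"
  proof (rule chain)
    show "cos (real k * b) \<le> \<bar>x \<bullet> y\<bar>" unfolding cd(1)[symmetric] using kb d b by (intro cos_monotone_0_pi_le) auto
  qed (use t cb b0 u kb d b in \<open>auto simp: k_def\<close>)
  moreover have "cos d' < cos (real k * b)" using kb d b by (intro cos_monotone_0_pi) auto
  ultimately show False using cd by simp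
qed

section \<open>The inverse map and equality of angles\<close>

text \<open>A choice of preimages inverts \<open>f\<close> only up to sign, which suffices under
  absolute values.\<close>

lemma inverse_map:
  obtains g where "sphere_map g" "\<And>y. y \<bullet> y = 1 \<Longrightarrow> g y \<bullet> g y = 1"
    "\<And>x y. x \<bullet> x = 1 \<Longrightarrow> y \<bullet> y = 1 \<Longrightarrow> \<bar>f (g x) \<bullet> f (g y)\<bar> = \<bar>x \<bullet> y\<bar>"
    "\<And>x y. x \<bullet> x = 1 \<Longrightarrow> y \<bullet> y = 1 \<Longrightarrow> \<bar>g (f x) \<bullet> g (f y)\<bar> = \<bar>x \<bullet> y\<bar>"
proof -
  obtain g where g: "\<And>y. y \<bullet> y = 1 \<Longrightarrow> g y \<bullet> g y = 1" "\<And>y. y \<bullet> y = 1 \<Longrightarrow> \<bar>f (g y) \<bullet> y\<bar> = 1"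
    using surj by metis
  have fg: "\<bar>f (g x) \<bullet> f (g y)\<bar> = \<bar>x \<bullet> y\<bar>" if "x \<bullet> x = 1" "y \<bullet> y = 1" for x y
  proof -
    have "x = f (g x) \<or> x = - f (g x)" "y = f (g y) \<or> y = - f (g y)"
      using that g unit unit_abs_inner_eq_1 by metis+
    then show ?thesis by (metis abs_minus_cancel inner_minus_left inner_minus_right)
  qed
  have gf: "\<bar>g (f x) \<bullet> g (f y)\<bar> = \<bar>x \<bullet> y\<bar>" if "x \<bullet> x = 1" "y \<bullet> y = 1" for x y
  proof -
    have "\<bar>g (f x) \<bullet> x\<bar> = 1" "\<bar>g (f y) \<bullet> y\<bar> = 1"
      using that same[of "g (f x)" x] same[of "g (f y)" y] g unit by blast+
    then have "x = g (f x) \<or> x = - g (f x)" "y = g (f y) \<or> y = - g (f y)"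
      using that g(1) unit unit_abs_inner_eq_1 by metis+
    then show ?thesis by (metis abs_minus_cancel inner_minus_left inner_minus_right)
  qed
  have "sphere_map g"
  proof
    fix x y :: 'a
    show "x \<bullet> x = 1 \<Longrightarrow> g x \<bullet> g x = 1" by (rule g)
    show "\<bar>g x \<bullet> g y\<bar> = 1 \<longleftrightarrow> \<bar>x \<bullet> y\<bar> = 1" if "x \<bullet> x = 1" "y \<bullet> y = 1"
      using same[of "g x" "g y"] fg[OF that] g that by simp
    show "\<exists>x. x \<bullet> x = 1 \<and> \<bar>g x \<bullet> y\<bar> = 1" if "y \<bullet> y = 1"
      using same[of "g (f y)" y] g[of "f y"] unit that by blast
  qed (rule orth)
  then show thesis using that g(1) fg gf by blast
qed

text \<open>The reverse inequality is \<open>abs_inner_mono\<close> for the inverse map at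
  \<open>f x\<close> and \<open>f y\<close>.\<close>

lemma abs_inner_eq:
  assumes c: "pres c" "0 < c" "c < 1" and u: "x \<bullet> x = 1" "y \<bullet> y = 1"
  shows "\<bar>f x \<bullet> f y\<bar> = \<bar>x \<bullet> y\<bar>"
proof (rule antisym)
  obtain g where g: "sphere_map g" "\<And>y. y \<bullet> y = 1 \<Longrightarrow> g y \<bullet> g y = 1"
    and fg: "\<And>x y. x \<bullet> x = 1 \<Longrightarrow> y \<bullet> y = 1 \<Longrightarrow> \<bar>f (g x) \<bullet> f (g y)\<bar> = \<bar>x \<bullet> y\<bar>"
    and gf: "\<And>x y. x \<bullet> x = 1 \<Longrightarrow> y \<bullet> y = 1 \<Longrightarrow> \<bar>g (f x) \<bullet> g (f y)\<bar> = \<bar>x \<bullet> y\<bar>"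
    using inverse_map by blast
  interpret g: sphere_map g by (rule g)
  have "g.pres c" unfolding g.pres_def using presD[OF c(1)] fg g(2) by metis
  from g.abs_inner_mono[OF this c(2,3), of "f x" "f y"] show "\<bar>f x \<bullet> f y\<bar> \<le> \<bar>x \<bullet> y\<bar>"
    using gf u unit by simp
qed (rule abs_inner_mono[OF assms])

end

subsection \<open>Wigner's theorem for real inner product spaces\<close>

lemma equal_up_to_sign:
  fixes a b :: "'a::real_inner"
  assumes "a \<bullet> a = r" "b \<bullet> b = r" "\<bar>a \<bullet> b\<bar> = r"
  shows "a = b \<or> a = - b"
proof -
  have "(a - b) \<bullet> (a - b) = 0 \<or> (a + b) \<bullet> (a + b) = 0"
    using assms by (auto simp: inner_simps inner_commute abs_if split: if_splits)
  then show ?thesis by (auto simp: eq_neg_iff_add_eq_0)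
qed

text \<open>The squared norms of the defects of additivity and homogeneity expand into inner
  products of values of \<open>U\<close>, and these cancel as they do for the arguments.\<close>

lemma inner_preserving_linear:
  fixes U :: "'a::real_inner \<Rightarrow> 'b::real_inner"
  assumes U: "\<And>v w. U v \<bullet> U w = v \<bullet> w"
  shows "linear U"
proof (rule linearI)
  fix v w r
  have "(U (v + w) - (U v + U w)) \<bullet> (U (v + w) - (U v + U w)) = 0"
    by (simp add: inner_simps U)
  then show "U (v + w) = U v + U w" by simp
  have "(U (r *\<^sub>R v) - r *\<^sub>R U v) \<bullet> (U (r *\<^sub>R v) - r *\<^sub>R U v) = 0"
    by (simp add: inner_simps U)
  then show "U (r *\<^sub>R v) = r *\<^sub>R U v" by simp
qed

text \<open>The phases of \<open>F\<close> are fixed by comparing \<open>F (e + v)\<close> with \<open>F e\<close>, which are never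
  orthogonal when \<open>v\<close> is orthogonal to the unit vector \<open>e\<close>.\<close>

lemma abs_inner_preserving_lift:
  fixes F :: "'a::real_inner \<Rightarrow> 'b::real_inner" and e :: 'a
  assumes e: "e \<bullet> e = 1" and F: "\<And>v w. \<bar>F v \<bullet> F w\<bar> = \<bar>v \<bullet> w\<bar>"
  obtains U where "\<And>v w. U v \<bullet> U w = v \<bullet> w" "\<And>v. F v = U v \<or> F v = - U v"
proof -
  have FF: "F v \<bullet> F v = v \<bullet> v" for v using F[of v v] by simp
  define G where "G v = (if F (e + v) \<bullet> F e < 0 then - F (e + v) else F (e + v)) - F e" for v
  define W where "W v = (v \<bullet> e) *\<^sub>R F e + G (v - (v \<bullet> e) *\<^sub>R e)" for v
  have Ge: "F (e + v) = F e + G v \<or> F (e + v) = - (F e + G v)" for v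
    by (auto simp: G_def)
  have G0: "G v \<bullet> F e = 0" "F e \<bullet> G v = 0" if "v \<bullet> e = 0" for v
  proof -
    have "\<bar>F (e + v) \<bullet> F e\<bar> = 1" using F[of "e + v" e] that e by (simp add: inner_simps)
    then show "G v \<bullet> F e = 0" using FF[of e] e by (auto simp: G_def inner_simps)
    then show "F e \<bullet> G v = 0" by (simp add: inner_commute)
  qed
  have sumG: "\<bar>1 + G v \<bullet> G w\<bar> = \<bar>1 + v \<bullet> w\<bar>" if "v \<bullet> e = 0" "w \<bullet> e = 0" for v w
  proof -
    have "\<bar>F (e + v) \<bullet> F (e + w)\<bar> = \<bar>(F e + G v) \<bullet> (F e + G w)\<bar>"
      using Ge[of v] Ge[of w]
      by (elim disjE) (simp_all only: inner_minus_left inner_minus_right abs_minus_cancel)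
    also have "\<dots> = \<bar>1 + G v \<bullet> G w\<bar>" using G0[OF that(1)] G0[OF that(2)] FF[of e] e by (simp add: inner_simps)
    finally show ?thesis using F[of "e + v" "e + w"] that e by (simp add: inner_simps inner_commute)
  qed
  have GG: "G v \<bullet> G v = v \<bullet> v" if "v \<bullet> e = 0" for v
  proof -
    have "1 + v \<bullet> v \<ge> 0" "1 + G v \<bullet> G v \<ge> 0" by (simp_all add: add_nonneg_nonneg)
    then show ?thesis using sumG[OF that that] by simp
  qed
  \<comment> \<open>\<open>F v\<close> is orthogonal to \<open>F e\<close>, so its inner products
    with \<open>G v\<close> and \<open>F (e + v)\<close> agree up to sign, and equality in
    Cauchy-Schwarz follows.\<close>
  have GF: "F v = G v \<or> F v = - G v" if v: "v \<bullet> e = 0" for v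
  proof (rule equal_up_to_sign[OF FF GG[OF v]])
    have "F v \<bullet> F e = 0" using F[of v e] v by simp
    then have "\<bar>F v \<bullet> G v\<bar> = \<bar>F v \<bullet> F (e + v)\<bar>" by (auto simp: G_def inner_simps)
    then show "\<bar>F v \<bullet> G v\<bar> = v \<bullet> v" using F[of v "e + v"] v by (simp add: inner_simps)
  qed
  \<comment> \<open>The value is known up to sign; comparing the absolute values after adding 1
    excludes the wrong sign unless it is zero.\<close>
  have Gi: "G v \<bullet> G w = v \<bullet> w" if "v \<bullet> e = 0" "w \<bullet> e = 0" for v w
  proof -
    have "\<bar>G v \<bullet> G w\<bar> = \<bar>v \<bullet> w\<bar>" using GF[OF that(1)] GF[OF that(2)] F[of v w] by auto
    then show ?thesis using sumG[OF that] by (auto simp: abs_if split: if_splits)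
  qed
  have p0: "(v - (v \<bullet> e) *\<^sub>R e) \<bullet> e = 0" for v using e by (simp add: inner_simps)
  have Wi: "W v \<bullet> W w = v \<bullet> w" for v w
    using G0[OF p0[of v]] G0[OF p0[of w]] Gi[OF p0[of v] p0[of w]] FF[of e] e
    by (simp add: W_def inner_simps inner_commute)
  have FW: "F v = W v \<or> F v = - W v" for v
  proof (cases "v \<bullet> e = 0")
    case True
    then show ?thesis using GF[of v] by (simp add: W_def)
  next
    case False
    \<comment> \<open>Scaling \<open>v\<close> to have \<open>e\<close>-component 1 reduces to
      \<open>e + w\<close>, where \<open>W\<close> agrees with \<open>F\<close> up to sign by
      construction.\<close>
    define w where "w = (1 / (v \<bullet> e)) *\<^sub>R v - e"
    have we: "w \<bullet> e = 0" using False e by (simp add: w_def inner_simps)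
    have v: "v = (v \<bullet> e) *\<^sub>R (e + w)" using False by (simp add: w_def)
    have "W (e + w) = F e + G w" using we e by (simp add: W_def inner_simps)
    then have 1: "F (e + w) = W (e + w) \<or> F (e + w) = - W (e + w)" using Ge[of w] by simp
    have "\<bar>F v \<bullet> W v\<bar> = \<bar>v \<bullet> e\<bar> * \<bar>F v \<bullet> W (e + w)\<bar>"
      using inner_preserving_linear[of W, OF Wi] by (subst (2) v) (simp add: linear_scale abs_mult)
    also have "\<dots> = \<bar>v \<bullet> e\<bar> * \<bar>v \<bullet> (e + w)\<bar>" using 1 F[of v "e + w"] by auto
    also have "\<dots> = \<bar>v \<bullet> v\<bar>" by (subst (4) v) (simp add: abs_mult)
    finally have "\<bar>F v \<bullet> W v\<bar> = v \<bullet> v" by simp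
    then show ?thesis by (rule equal_up_to_sign[OF FF Wi])
  qed
  show thesis using that[of W] Wi FW by blast
qed

section \<open>From lines to unit vectors and back\<close>

lemma dim_at_least_3_orth:
  fixes a b :: "'a::real_inner"
  assumes "dim_at_least 3 TYPE('a)"
  shows "\<exists>e::'a. e \<bullet> e = 1 \<and> e \<bullet> a = 0 \<and> e \<bullet> b = 0"
proof -
  obtain B :: "'a set" where B: "independent B" "span B = UNIV" "finite B \<Longrightarrow> 3 \<le> card B"
    using assms unfolding dim_at_least_def by blast
  have "\<exists>v. v \<notin> span {a, b}"
  proof (rule ccontr)
    assume "\<nexists>v. v \<notin> span {a, b}"
    then have "finite B \<and> card B \<le> card {a, b}"
      using independent_span_bound[of "{a, b}" B] B(1) by auto
    moreover have "card {a, b} \<le> 2" by (simp add: card_insert_if)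
    ultimately show False using B(3) by linarith
  qed
  then obtain v where v: "v \<notin> span {a, b}" by blast
  define b' where "b' = b - (b \<bullet> a / (a \<bullet> a)) *\<^sub>R a"
  \<comment> \<open>Gram-Schmidt applied to a vector outside the span; for zero \<open>a\<close> or
    \<open>b'\<close> the corresponding term is zero.\<close>
  define w where "w = v - (v \<bullet> a / (a \<bullet> a)) *\<^sub>R a - (v \<bullet> b' / (b' \<bullet> b')) *\<^sub>R b'"
  have b'a: "b' \<bullet> a = 0" "a \<bullet> b' = 0" by (cases "a = 0"; simp add: b'_def inner_simps inner_commute)+
  have wa: "w \<bullet> a = 0" by (cases "a = 0") (simp_all add: w_def inner_simps b'a)
  have "w \<bullet> b' = 0" by (cases "b' = 0") (simp_all add: w_def inner_simps b'a)
  then have wb: "w \<bullet> b = 0" using wa by (simp add: b'_def inner_simps)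
  have "w \<noteq> 0"
  proof
    assume "w = 0"
    then have "v = (v \<bullet> a / (a \<bullet> a)) *\<^sub>R a + (v \<bullet> b' / (b' \<bullet> b')) *\<^sub>R b'" by (simp add: w_def algebra_simps)
    moreover have "b' \<in> span {a, b}" unfolding b'_def by (intro span_diff span_scale span_base) auto
    ultimately have "v \<in> span {a, b}" by (metis insertI1 span_add span_base span_scale)
    with v show False by blast
  qed
  then have "(1 / norm w) *\<^sub>R w \<bullet> (1 / norm w) *\<^sub>R w = 1"
    by (simp add: power2_norm_eq_inner[symmetric] power2_eq_square)
  then show ?thesis using wa wb by (intro exI[of _ "(1 / norm w) *\<^sub>R w"]) simp
qed

lemma line_of_scaleR: "k \<noteq> 0 \<Longrightarrow> line_of (k *\<^sub>R v) = line_of v"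
  unfolding line_of_def using span_image_scale[of "{v}" "\<lambda>_. k"] by simp

lemma line_of_uminus: "line_of (- v) = line_of v"
  using line_of_scaleR[of "- 1" v] by simp

lemma line_of_eq_iff:
  fixes u v :: "'a::real_inner"
  assumes "u \<bullet> u = 1" "v \<bullet> v = 1"
  shows "line_of u = line_of v \<longleftrightarrow> \<bar>u \<bullet> v\<bar> = 1"
proof
  assume "line_of u = line_of v"
  moreover have "u \<noteq> 0" using assms by auto
  ultimately obtain k where k: "u = k *\<^sub>R v" by (rule line_of_eqD)
  then have "k^2 = 1" using assms by (simp add: power2_eq_square)
  then show "\<bar>u \<bullet> v\<bar> = 1" using k assms by (simp add: power2_eq_1_iff) auto
next
  assume "\<bar>u \<bullet> v\<bar> = 1"
  then have "v = u \<or> v = - u" using unit_abs_inner_eq_1[OF assms] by blast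
  then show "line_of u = line_of v" using line_of_uminus[of u] by metis
qed

lemma lines_unit:
  assumes "L \<in> lines"
  obtains u where "u \<bullet> u = 1" "L = line_of u"
proof -
  obtain v where v: "v \<noteq> 0" "L = line_of v" using assms by (auto simp: lines_eq)
  then have "L = line_of ((1 / norm v) *\<^sub>R v)" by (simp add: line_of_scaleR)
  moreover have "(1 / norm v) *\<^sub>R v \<bullet> (1 / norm v) *\<^sub>R v = 1"
    using v by (simp add: power2_norm_eq_inner[symmetric] power2_eq_square)
  ultimately show thesis using that by blast
qed

lemma line_angle_unit:
  fixes u v :: "'a::real_inner"
  assumes u: "u \<bullet> u = 1" "v \<bullet> v = 1" and \<alpha>: "0 \<le> \<alpha>" "\<alpha> \<le> pi"
  shows "line_angle (line_of u) (line_of v) = \<alpha> \<longleftrightarrow> \<bar>u \<bullet> v\<bar> = cos \<alpha>"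
proof -
  have "u \<noteq> 0" "v \<noteq> 0" using u by auto
  moreover have "norm u = 1" "norm v = 1" using u by (simp_all add: norm_eq_sqrt_inner)
  ultimately have "line_angle (line_of u) (line_of v) = arccos \<bar>u \<bullet> v\<bar>"
    by (simp add: line_angle_line_of)
  moreover have "\<bar>u \<bullet> v\<bar> \<le> 1" using unit_inner_le_1 u by blast
  ultimately show ?thesis using \<alpha> by (auto simp: cos_arccos_abs arccos_cos)
qed

text \<open>An isometry of an infinite-dimensional space need not be onto, so surjectivity of
  \<open>U\<close> is derived from that of \<open>f\<close> up to sign.\<close>

lemma (in sphere_map) wigner_lift:
  assumes eq: "\<And>x y. x \<bullet> x = 1 \<Longrightarrow> y \<bullet> y = 1 \<Longrightarrow> \<bar>f x \<bullet> f y\<bar> = \<bar>x \<bullet> y\<bar>"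
  obtains U where "linear U" "bij U" "\<And>v. norm (U v) = norm v"
    "\<And>x. x \<bullet> x = 1 \<Longrightarrow> f x = U x \<or> f x = - U x"
proof -
  \<comment> \<open>The positively homogeneous extension of \<open>f\<close> from the unit sphere,
    with \<open>F 0 = 0\<close>.\<close>
  define F where "F v = norm v *\<^sub>R f ((1 / norm v) *\<^sub>R v)" for v
  obtain e :: 'a where e: "e \<bullet> e = 1" using orth by blast
  have n1: "(1 / norm v) *\<^sub>R v \<bullet> (1 / norm v) *\<^sub>R v = 1" if "v \<noteq> 0" for v :: 'a
    using that by (simp add: power2_norm_eq_inner[symmetric] power2_eq_square)
  have F: "\<bar>F v \<bullet> F w\<bar> = \<bar>v \<bullet> w\<bar>" for v w
  proof (cases "v = 0 \<or> w = 0")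
    case False
    then have "\<bar>F v \<bullet> F w\<bar> = norm v * norm w * \<bar>(1 / norm v) *\<^sub>R v \<bullet> (1 / norm w) *\<^sub>R w\<bar>"
      using eq[OF n1[of v] n1[of w]] by (simp add: F_def abs_mult)
    then show ?thesis using False by (simp add: abs_mult)
  qed (auto simp: F_def)
  obtain U where U: "\<And>v w. U v \<bullet> U w = v \<bullet> w" "\<And>v. F v = U v \<or> F v = - U v"
    using abs_inner_preserving_lift[OF e F] by blast
  have lin: "linear U" by (rule inner_preserving_linear[OF U(1)])
  have norm: "norm (U v) = norm v" for v by (simp add: norm_eq_sqrt_inner U)
  have fU: "f x = U x \<or> f x = - U x" if "x \<bullet> x = 1" for x
    using U(2)[of x] that by (simp add: F_def norm_eq_sqrt_inner)
  have "inj U" using lin norm by (metis linear_injective_0 norm_eq_zero)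
  moreover have "surj U"
  proof (rule surjI[of U "\<lambda>y. SOME v. U v = y"], rule someI_ex)
    fix y
    show "\<exists>v. U v = y"
    proof (cases "y = 0")
      case True
      then show ?thesis using lin linear_0 by blast
    next
      case False
      obtain x where x: "x \<bullet> x = 1" "\<bar>f x \<bullet> (1 / norm y) *\<^sub>R y\<bar> = 1" using surj[OF n1[OF False]] by blast
      then have "(1 / norm y) *\<^sub>R y = f x \<or> (1 / norm y) *\<^sub>R y = - f x"
        using unit_abs_inner_eq_1 unit n1[OF False] by blast
      then have "(1 / norm y) *\<^sub>R y = U x \<or> (1 / norm y) *\<^sub>R y = U (- x)"
        using fU[OF x(1)] linear_neg[OF lin, of x] by auto
      then obtain v where v: "(1 / norm y) *\<^sub>R y = U v" by blast
      have "U (norm y *\<^sub>R v) = y" using False by (simp add: linear_scale[OF lin] flip: v)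
      then show ?thesis by blast
    qed
  qed
  ultimately show thesis using that[of U] lin norm fU by (simp add: bij_def)
qed

theorem theorem1:
  fixes \<phi> :: "'a::real_inner set \<Rightarrow> 'a set" and \<alpha> :: real
  assumes "dim_at_least 3 TYPE('a)"
    and "0 < \<alpha>" and "\<alpha> < pi / 2"
    and "bij_betw \<phi> lines lines"
    and "\<And>L M. L \<in> lines \<Longrightarrow> M \<in> lines \<Longrightarrow>
           line_angle L M = \<alpha> \<longleftrightarrow> line_angle (\<phi> L) (\<phi> M) = \<alpha>"
  shows "wigner_symmetry \<phi>"
proof -
  define c where "c = cos \<alpha>"
  have c: "0 < c" "c < 1"
    using assms(2,3) cos_gt_zero[of \<alpha>] cos_monotone_0_pi[of 0 \<alpha>] by (simp_all add: c_def)
  have in_lines: "line_of x \<in> lines" if "x \<bullet> x = 1" for x :: 'a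
    using that by (intro line_of_in_lines) auto
  have "\<exists>u. u \<bullet> u = 1 \<and> \<phi> (line_of x) = line_of u" if "x \<bullet> x = 1" for x
    using lines_unit bij_betwE[OF assms(4)] in_lines[OF that] by metis
  then obtain f where f: "\<And>x. x \<bullet> x = 1 \<Longrightarrow> f x \<bullet> f x = 1" "\<And>x. x \<bullet> x = 1 \<Longrightarrow> \<phi> (line_of x) = line_of (f x)"
    by metis
  interpret sphere_map f
  proof
    show "\<bar>f x \<bullet> f y\<bar> = 1 \<longleftrightarrow> \<bar>x \<bullet> y\<bar> = 1" if "x \<bullet> x = 1" "y \<bullet> y = 1" for x y
      using that bij_betw_imp_inj_on[OF assms(4)] in_lines f line_of_eq_iff
      by (metis inj_onD)
    show "\<exists>x. x \<bullet> x = 1 \<and> \<bar>f x \<bullet> y\<bar> = 1" if y: "y \<bullet> y = 1" for y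
    proof -
      obtain L where "L \<in> lines" "\<phi> L = line_of y"
        using bij_betw_imp_surj_on[OF assms(4)] in_lines[OF y] by (metis imageE)
      moreover then obtain x where "x \<bullet> x = 1" "L = line_of x" using lines_unit by blast
      ultimately show ?thesis using f y line_of_eq_iff by metis
    qed
  qed (use f dim_at_least_3_orth[OF assms(1)] in auto)
  have "pres c"
    unfolding pres_def
  proof (intro allI impI)
    fix x y :: 'a assume u: "x \<bullet> x = 1" "y \<bullet> y = 1"
    have \<alpha>: "0 \<le> \<alpha>" "\<alpha> \<le> pi" using assms(2,3) pi_gt_zero by linarith+
    have "\<bar>x \<bullet> y\<bar> = c \<longleftrightarrow> line_angle (line_of x) (line_of y) = \<alpha>"
      unfolding c_def by (rule line_angle_unit[OF u \<alpha>, symmetric])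
    also have "\<dots> \<longleftrightarrow> line_angle (line_of (f x)) (line_of (f y)) = \<alpha>"
      using assms(5)[OF in_lines in_lines, OF u] f(2) u by simp
    also have "\<dots> \<longleftrightarrow> \<bar>f x \<bullet> f y\<bar> = c"
      unfolding c_def by (rule line_angle_unit[OF f(1) f(1) \<alpha>, OF u])
    finally show "\<bar>f x \<bullet> f y\<bar> = c \<longleftrightarrow> \<bar>x \<bullet> y\<bar> = c" ..
  qed
  then have "\<bar>f x \<bullet> f y\<bar> = \<bar>x \<bullet> y\<bar>" if "x \<bullet> x = 1" "y \<bullet> y = 1" for x y
    using abs_inner_eq c that by blast
  then obtain U where U: "linear U" "bij U" "\<And>v. norm (U v) = norm v"
    "\<And>x. x \<bullet> x = 1 \<Longrightarrow> f x = U x \<or> f x = - U x"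
    using wigner_lift by blast
  have "\<phi> (line_of v) = line_of (U v)" if "v \<noteq> 0" for v
  proof -
    define x where "x = (1 / norm v) *\<^sub>R v"
    have x: "x \<bullet> x = 1" using that by (simp add: x_def power2_norm_eq_inner[symmetric] power2_eq_square)
    have "\<phi> (line_of v) = line_of (f x)" using f(2)[OF x] that by (simp add: x_def line_of_scaleR)
    also have "\<dots> = line_of (U x)" using U(4)[OF x] line_of_uminus[of "U x"] by metis
    also have "\<dots> = line_of (U v)" using that by (simp add: x_def linear_scale[OF U(1)] line_of_scaleR)
    finally show ?thesis .
  qed
  then show ?thesis unfolding wigner_symmetry_def using U by blast
qed

end
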